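(* Let $S$ be a spider with $d\ge 2$ legs and an odd number $n$ of vertices, having exactly two legs of odd length, of lengths $2k_1+1$ and $2k_2+1$ ($k_1,k_2\ge 0$), and $d-2$ legs of even lengths $2k_3,\ldots,2k_d$ ($k_3,\ldots,k_d\ge 1$). Then $$[e_{(3,\,2^{k_1+\cdots+k_d})}]X_S=4(k_1+k_2-k_3-\cdots-k_d)+2d-1.$$ In particular, if $d\ge 4$, $S$ has exactly two legs of odd length, and a longest leg of $S$ has even length, then $S$ is not $e$-positive.
   Context: A spider with legs of lengths $\lambda_1,\ldots,\lambda_d$ (positive integers) is the tree consisting of a vertex $v$ (the center) together with $d$ vertex-disjoint paths (legs) having $\lambda_1,\ldots,\lambda_d$ vertices respectively, where $v$ is joined by an edge to one endpoint of each leg; it has $1+\sum\lambda_i$ vertices. $(3,2^{k})$ denotes the partition with one part $3$ and $k$ parts $2$. The chromatic symmetric function of $G$ is $X_G=\sum_\kappa \prod_{v} x_{\kappa(v)}$ over proper colorings $\kappa$; $[e_\mu]X_G$ denotes the coefficient of $e_\mu$ in the expansion of $X_G$ in elementary symmetric functions; $G$ is $e$-positive if all these coefficients are nonnegative. *)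

theory Defs
  imports Main "HOL-Library.FuncSet" "HOL-Library.Multiset"
begin

text \<open>Symmetric functions are formal power series in countably many variables
  x_0, x_1, ...; a monomial is given by its exponent vector alpha :: nat => nat.
  We represent a symmetric function by its coefficient function.\<close>

definition proper_colorings :: "'a set \<Rightarrow> ('a \<Rightarrow> 'a \<Rightarrow> bool) \<Rightarrow> ('a \<Rightarrow> nat) set" where
  "proper_colorings V E =
     {\<kappa> \<in> V \<rightarrow>\<^sub>E (UNIV :: nat set). \<forall>u\<in>V. \<forall>v\<in>V. E u v \<longrightarrow> \<kappa> u \<noteq> \<kappa> v}"

text \<open>Coefficient of x^alpha in the chromatic symmetric function
  X_G = sum over proper colourings kappa of prod_v x_(kappa v).\<close>
definition chrom_coeff :: "'a set \<Rightarrow> ('a \<Rightarrow> 'a \<Rightarrow> bool) \<Rightarrow> (nat \<Rightarrow> nat) \<Rightarrow> int" where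
  "chrom_coeff V E \<alpha> =
     int (card {\<kappa> \<in> proper_colorings V E. \<forall>i. card {v \<in> V. \<kappa> v = i} = \<alpha> i})"

text \<open>Coefficient of x^alpha in e_mu = e_(mu_1) * ... * e_(mu_l), where
  e_m = sum over m-element sets S of variables of prod_(j in S) x_j; expanding
  the product gives one term per tuple (S_1,...,S_l).\<close>
definition elem_coeff :: "nat list \<Rightarrow> (nat \<Rightarrow> nat) \<Rightarrow> int" where
  "elem_coeff \<mu> \<alpha> =
     int (card {Ss :: nat set list. length Ss = length \<mu> \<and>
            (\<forall>i < length \<mu>. finite (Ss ! i) \<and> card (Ss ! i) = \<mu> ! i) \<and>
            (\<forall>j. \<alpha> j = card {i. i < length \<mu> \<and> j \<in> Ss ! i})})"

definition partitions :: "nat \<Rightarrow> nat list set" where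
  "partitions n = {\<mu>. sorted_wrt (\<ge>) \<mu> \<and> (\<forall>x \<in> set \<mu>. 0 < x) \<and> sum_list \<mu> = n}"

definition is_e_expansion :: "'a set \<Rightarrow> ('a \<Rightarrow> 'a \<Rightarrow> bool) \<Rightarrow> (nat list \<Rightarrow> int) \<Rightarrow> bool" where
  "is_e_expansion V E c \<longleftrightarrow>
     (\<forall>\<mu>. \<mu> \<notin> partitions (card V) \<longrightarrow> c \<mu> = 0) \<and>
     (\<forall>\<alpha>. chrom_coeff V E \<alpha> = (\<Sum>\<mu> \<in> partitions (card V). c \<mu> * elem_coeff \<mu> \<alpha>))"

text \<open>[e_mu] X_G (the e-expansion is unique since the e_mu are linearly independent).\<close>
definition e_coeff :: "'a set \<Rightarrow> ('a \<Rightarrow> 'a \<Rightarrow> bool) \<Rightarrow> nat list \<Rightarrow> int" where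
  "e_coeff V E \<mu> = (THE c. is_e_expansion V E c) \<mu>"

definition e_positive :: "'a set \<Rightarrow> ('a \<Rightarrow> 'a \<Rightarrow> bool) \<Rightarrow> bool" where
  "e_positive V E \<longleftrightarrow> (\<forall>\<mu>. 0 \<le> e_coeff V E \<mu>)"

text \<open>The spider with legs ls = [lambda_1, ..., lambda_d]: centre (0,0), and vertex (i,j)
  is the j-th vertex (1 <= j <= lambda_i) of leg i (1 <= i <= d), counted from the centre.\<close>
definition spider_V :: "nat list \<Rightarrow> (nat \<times> nat) set" where
  "spider_V ls = {(0,0)} \<union> {(i,j). 1 \<le> i \<and> i \<le> length ls \<and> 1 \<le> j \<and> j \<le> ls ! (i - 1)}"

definition spider_E :: "nat list \<Rightarrow> (nat \<times> nat) \<Rightarrow> (nat \<times> nat) \<Rightarrow> bool" where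
  "spider_E ls u v \<longleftrightarrow> u \<in> spider_V ls \<and> v \<in> spider_V ls \<and>
     ((u = (0,0) \<and> 1 \<le> fst v \<and> snd v = 1) \<or>
      (v = (0,0) \<and> 1 \<le> fst u \<and> snd u = 1) \<or>
      (1 \<le> fst u \<and> fst u = fst v \<and> (snd v = snd u + 1 \<or> snd u = snd v + 1)))"

end

theory Submission
  imports Defs "HOL-Computational_Algebra.Fundamental_Theorem_Algebra"
begin

text \<open>Evaluating \<open>X_S\<close> and its \<open>e\<close>-expansion at finitely many elements of a commutative ring gives
  an identity in that ring; the points are chosen so that almost all \<open>e_\<mu>\<close> drop out. At
  \<open>(1, -1 - z, z)\<close> we have \<open>e_1 = 0\<close>, \<open>e_2 = -1 - z - z^2\<close>, \<open>e_3 = -z - z^2\<close>, so for odd \<open>n\<close> the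
  coefficient of \<open>z\<close> isolates \<open>[e_(3,2^K)] X_S\<close>, while the colourings of the spider factor over
  its legs.

  For the second claim let \<open>L\<close> be the longest leg. If \<open>e_1 = \<dots> = e_L = 0\<close> at a point, then all paths
  on at most \<open>L\<close> vertices evaluate to \<open>0\<close>, which forces \<open>X_S = p_n\<close> (\<open>n\<close> odd). When
  \<open>n = a + b\<close> with \<open>L < a < b\<close>, choosing the point with generating polynomial
  \<open>(1 + \<alpha> z^a) (1 + \<beta> z^b)\<close> makes \<open>p_n\<close> split into a function of \<open>\<alpha>\<close> plus a function of \<open>\<beta>\<close>, so
  \<open>[e_(b,a)] X_S = - [e_n] X_S < 0\<close>. Otherwise \<open>n \<le> 2 L + 1\<close>, and the formula for
  \<open>[e_(3,2^K)] X_S\<close> is negative.\<close>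

section \<open>Existence and uniqueness of the \<open>e\<close>-expansion\<close>

text \<open>\<open>S - I\<close> and \<open>I - S\<close> have equal size; the elements of
  \<open>I - S\<close> lie below \<open>card S\<close>, those of \<open>S - I\<close> do not. So
  passing from \<open>I\<close> to \<open>S\<close> never lowers the sum, and keeps it only if
  nothing is exchanged.\<close>

lemma sum_initial_segment_le:
  fixes S :: "nat set"
  assumes "finite S"
  shows "\<Sum>{..<card S} \<le> \<Sum>S"
    and "\<Sum>{..<card S} = \<Sum>S \<Longrightarrow> S = {..<card S}"
proof -
  define I where "I = {..<card S}"
  have fin: "finite (S - I)" "finite (I - S)" "finite (S \<inter> I)" "finite I"
    using assms by (auto simp: I_def)
  have card_eq: "card (S - I) = card (I - S)"
    using assms fin by (simp add: card_Diff_subset_Int Int_commute I_def)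
  \<comment> \<open>The extra summand \<open>card (I - S)\<close> records strict inequality for each
    element; it settles the equality case.\<close>
  have le1: "\<Sum>(I - S) + card (I - S) \<le> card (I - S) * card S"
  proof -
    have "(\<Sum>i\<in>I - S. i + 1) \<le> (\<Sum>i\<in>I - S. card S)"
      by (rule sum_mono) (auto simp: I_def)
    then show ?thesis unfolding sum.distrib by simp
  qed
  have le2: "card (S - I) * card S \<le> \<Sum>(S - I)"
  proof -
    have "(\<Sum>i\<in>S - I. card S) \<le> (\<Sum>i\<in>S - I. i)"
      by (rule sum_mono) (auto simp: I_def)
    then show ?thesis by simp
  qed
  have S: "\<Sum>S = \<Sum>(S \<inter> I) + \<Sum>(S - I)"
    using assms by (rule sum.Int_Diff)
  have I: "\<Sum>I = \<Sum>(S \<inter> I) + \<Sum>(I - S)"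
    using sum.Int_Diff[OF fin(4), of "\<lambda>x. x" S] by (simp add: Int_commute)
  show "\<Sum>{..<card S} \<le> \<Sum>S"
    using le1 le2 S I card_eq by (simp flip: I_def)
  assume "\<Sum>{..<card S} = \<Sum>S"
  then have "card (I - S) = 0"
    using le1 le2 S I card_eq by (simp flip: I_def)
  then have "I - S = {}" "S - I = {}" using card_eq fin by (metis card_0_eq)+
  then show "S = {..<card S}" by (auto simp: I_def)
qed

definition elem_tuples :: "nat list \<Rightarrow> (nat \<Rightarrow> nat) \<Rightarrow> nat set list set" where
  "elem_tuples \<mu> \<alpha> = {Ss. length Ss = length \<mu> \<and>
     (\<forall>i < length \<mu>. finite (Ss ! i) \<and> card (Ss ! i) = \<mu> ! i) \<and>
     (\<forall>j. \<alpha> j = card {i. i < length \<mu> \<and> j \<in> Ss ! i})}"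

lemma elem_coeff_eq_card: "elem_coeff \<mu> \<alpha> = int (card (elem_tuples \<mu> \<alpha>))"
  by (simp add: elem_coeff_def elem_tuples_def)

text \<open>Indexed from 0 and padded with zeros, so that the conjugate partition is itself an
  exponent vector.\<close>

definition conjugate :: "nat list \<Rightarrow> nat \<Rightarrow> nat" where
  "conjugate \<mu> j = card {i. i < length \<mu> \<and> j < \<mu> ! i}"

text \<open>The weight \<open>\<Sum>j. j * \<alpha> j\<close> of the exponent vectors in \<open>e_\<mu>\<close> is minimal exactly at the conjugate
  of \<open>\<mu>\<close>; this minimum makes the matrix of the \<open>e_\<mu>\<close> unitriangular.\<close>

definition rank :: "nat list \<Rightarrow> nat" where
  "rank \<mu> = (\<Sum>i<length \<mu>. \<Sum>{..<\<mu> ! i})"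

text \<open>Double counting of the pairs of a position \<open>i\<close> and an element
  \<open>j\<close> of \<open>Ss ! i\<close>, with weight 1 for the degree and weight
  \<open>j\<close> for the second sum.\<close>

lemma tuple_weight:
  assumes "Ss \<in> elem_tuples \<mu> \<alpha>" "\<And>j. N \<le> j \<Longrightarrow> \<alpha> j = 0"
  shows "(\<Sum>j<N. \<alpha> j) = sum_list \<mu>" "(\<Sum>j<N. j * \<alpha> j) = (\<Sum>i<length \<mu>. \<Sum>(Ss ! i))"
    "\<And>i. i < length \<mu> \<Longrightarrow> Ss ! i \<subseteq> {..<N}"
proof -
  show sub: "Ss ! i \<subseteq> {..<N}" if "i < length \<mu>" for i
  proof
    fix j assume "j \<in> Ss ! i"
    then have "i \<in> {i. i < length \<mu> \<and> j \<in> Ss ! i}" using that by simp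
    then have "card {i. i < length \<mu> \<and> j \<in> Ss ! i} \<noteq> 0" by (subst card_0_eq) auto
    then have "\<alpha> j \<noteq> 0" using assms(1) by (auto simp: elem_tuples_def)
    then show "j \<in> {..<N}" using assms(2) by (meson lessThan_iff not_le)
  qed
  have key: "(\<Sum>j<N. f j * \<alpha> j) = (\<Sum>i<length \<mu>. sum f (Ss ! i))" for f :: "nat \<Rightarrow> nat"
  proof -
    have "(\<Sum>j<N. f j * \<alpha> j) = (\<Sum>j<N. \<Sum>i<length \<mu>. if j \<in> Ss ! i then f j else 0)"
    proof (rule sum.cong[OF refl])
      fix j
      have "\<alpha> j = card {i \<in> {..<length \<mu>}. j \<in> Ss ! i}"
        using assms(1) by (simp add: elem_tuples_def)
      then show "f j * \<alpha> j = (\<Sum>i<length \<mu>. if j \<in> Ss ! i then f j else 0)"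
        by (simp add: sum.inter_filter[symmetric])
    qed
    also have "\<dots> = (\<Sum>i<length \<mu>. \<Sum>j<N. if j \<in> Ss ! i then f j else 0)"
      by (rule sum.swap)
    also have "\<dots> = (\<Sum>i<length \<mu>. sum f (Ss ! i))"
    proof (rule sum.cong[OF refl])
      fix i assume "i \<in> {..<length \<mu>}"
      then have "{j \<in> {..<N}. j \<in> Ss ! i} = Ss ! i" using sub by auto
      then show "(\<Sum>j<N. if j \<in> Ss ! i then f j else 0) = sum f (Ss ! i)"
        by (simp flip: sum.inter_filter)
    qed
    finally show ?thesis .
  qed
  show "(\<Sum>j<N. j * \<alpha> j) = (\<Sum>i<length \<mu>. \<Sum>(Ss ! i))" using key[of id] by simp
  have "(\<Sum>i<length \<mu>. card (Ss ! i)) = (\<Sum>i<length \<mu>. \<mu> ! i)"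
    using assms(1) by (intro sum.cong) (auto simp: elem_tuples_def)
  then show "(\<Sum>j<N. \<alpha> j) = sum_list \<mu>" using key[of "\<lambda>_. 1"]
    by (simp add: sum_list_sum_nth atLeast0LessThan)
qed

lemma initial_tuple: "map (\<lambda>m. {..<m}) \<mu> \<in> elem_tuples \<mu> (conjugate \<mu>)"
  by (auto simp: elem_tuples_def conjugate_def intro!: arg_cong[where f = card])

lemma conjugate_eq_0: "sum_list \<mu> \<le> j \<Longrightarrow> conjugate \<mu> j = 0"
proof -
  assume le: "sum_list \<mu> \<le> j"
  have "\<not> j < \<mu> ! i" if "i < length \<mu>" for i
    using elem_le_sum_list[OF that] le by simp
  then have "{i. i < length \<mu> \<and> j < \<mu> ! i} = {}" by blast
  then show ?thesis by (simp only: conjugate_def card.empty)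
qed

lemma conjugate_weight: "(\<Sum>j<sum_list \<mu>. j * conjugate \<mu> j) = rank \<mu>"
  using tuple_weight(2)[OF initial_tuple conjugate_eq_0[of \<mu>]] by (simp add: rank_def)

lemma sorted_ge_eqI:
  fixes \<mu> \<nu> :: "nat list"
  assumes "sorted_wrt (\<ge>) \<mu>" "sorted_wrt (\<ge>) \<nu>" "mset \<mu> = mset \<nu>"
  shows "\<mu> = \<nu>"
proof -
  have "sort \<nu> = rev \<mu>" "sort \<nu> = rev \<nu>"
    using assms by (auto intro!: properties_for_sort simp: sorted_wrt_rev)
  then show ?thesis by simp
qed

lemma conjugate_eq_length: "conjugate \<mu> j = length (filter (\<lambda>m. j < m) \<mu>)"
  by (simp add: conjugate_def length_filter_conv_card)

text \<open>The multiplicity of a part k + 1 is the drop of the conjugate from k to k + 1, and 0 is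
  not a part.\<close>

lemma conjugate_inj:
  assumes "\<mu> \<in> partitions n" "\<nu> \<in> partitions n" "conjugate \<mu> = conjugate \<nu>"
  shows "\<mu> = \<nu>"
proof (rule sorted_ge_eqI)
  show "mset \<mu> = mset \<nu>"
  proof (rule multiset_eqI)
    fix m
    show "count (mset \<mu>) m = count (mset \<nu>) m"
    proof (cases m)
      case 0
      have "0 \<notin> set \<mu>" "0 \<notin> set \<nu>" using assms by (auto simp: partitions_def)
      then show ?thesis using 0 by (metis count_mset_0_iff)
    next
      case (Suc k)
      have "count (mset xs) (Suc k) + conjugate xs (Suc k) = conjugate xs k" for xs
        by (induction xs) (auto simp: conjugate_eq_length)
      then show ?thesis using assms(3) Suc by (metis add_right_cancel)
    qed
  qed
qed (use assms in \<open>auto simp: partitions_def\<close>)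

text \<open>A tuple of content \<open>conjugate \<nu>\<close> has weight \<open>rank \<nu>\<close>,
  and its set sizes force weight at least \<open>rank \<mu>\<close>. Equality makes every set an
  initial segment, so the content is also \<open>conjugate \<mu>\<close>.\<close>

lemma elem_coeff_triangular:
  assumes "\<mu> \<in> partitions n" "\<nu> \<in> partitions n" "elem_coeff \<mu> (conjugate \<nu>) \<noteq> 0"
  shows "\<nu> = \<mu> \<or> rank \<mu> < rank \<nu>"
proof (rule disjCI)
  assume "\<not> rank \<mu> < rank \<nu>"
  obtain Ss where Ss: "Ss \<in> elem_tuples \<mu> (conjugate \<nu>)"
    using assms(3) by (cases "elem_tuples \<mu> (conjugate \<nu>) = {}") (auto simp: elem_coeff_eq_card)
  have fc: "finite (Ss ! i)" "card (Ss ! i) = \<mu> ! i" if "i < length \<mu>" for i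
    using Ss that by (auto simp: elem_tuples_def)
  have "rank \<nu> = (\<Sum>i<length \<mu>. \<Sum>(Ss ! i))"
    using tuple_weight(2)[OF Ss conjugate_eq_0] conjugate_weight[of \<nu>] by simp
  moreover have le: "\<Sum>{..<\<mu> ! i} \<le> \<Sum>(Ss ! i)" if "i < length \<mu>" for i
    using sum_initial_segment_le(1) fc that by metis
  ultimately have eq: "(\<Sum>i<length \<mu>. \<Sum>(Ss ! i)) = (\<Sum>i<length \<mu>. \<Sum>{..<\<mu> ! i})"
    using \<open>\<not> rank \<mu> < rank \<nu>\<close> unfolding rank_def[of \<mu>] by (intro antisym[OF _ sum_mono]) auto
  have "\<Sum>{..<\<mu> ! i} = \<Sum>(Ss ! i)" if i: "i < length \<mu>" for i
  proof (rule ccontr)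
    assume "\<Sum>{..<\<mu> ! i} \<noteq> \<Sum>(Ss ! i)"
    then have "(\<Sum>i<length \<mu>. \<Sum>{..<\<mu> ! i}) < (\<Sum>i<length \<mu>. \<Sum>(Ss ! i))"
      using le i by (intro sum_strict_mono_ex1) (auto simp: le_less)
    then show False using eq by simp
  qed
  then have "Ss ! i = {..<\<mu> ! i}" if "i < length \<mu>" for i
    using sum_initial_segment_le(2) fc that by metis
  then have "conjugate \<nu> j = conjugate \<mu> j" for j
    using Ss by (auto simp: elem_tuples_def conjugate_def intro!: arg_cong[where f = card])
  then show "\<nu> = \<mu>" using conjugate_inj assms by blast
qed

lemma elem_coeff_diag: "elem_coeff \<mu> (conjugate \<mu>) = 1"
proof -
  have "Ss = map (\<lambda>m. {..<m}) \<mu>" if Ss: "Ss \<in> elem_tuples \<mu> (conjugate \<mu>)" for Ss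
  proof -
    have fc: "finite (Ss ! i)" "card (Ss ! i) = \<mu> ! i" if "i < length \<mu>" for i
      using Ss that by (auto simp: elem_tuples_def)
    have eq: "(\<Sum>i<length \<mu>. \<Sum>{..<\<mu> ! i}) = (\<Sum>i<length \<mu>. \<Sum>(Ss ! i))"
      using tuple_weight(2)[OF Ss conjugate_eq_0] conjugate_weight[of \<mu>] by (simp add: rank_def)
    have le: "\<Sum>{..<\<mu> ! i} \<le> \<Sum>(Ss ! i)" if "i < length \<mu>" for i
      using sum_initial_segment_le(1) fc that by metis
    have "\<Sum>{..<\<mu> ! i} = \<Sum>(Ss ! i)" if "i < length \<mu>" for i
      using sum_mono_inv[OF eq] le that by auto
    then have "Ss ! i = {..<\<mu> ! i}" if "i < length \<mu>" for i
      using sum_initial_segment_le(2) fc that by metis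
    then show ?thesis using Ss by (intro nth_equalityI) (auto simp: elem_tuples_def)
  qed
  then have "elem_tuples \<mu> (conjugate \<mu>) = {map (\<lambda>m. {..<m}) \<mu>}"
    using initial_tuple by blast
  then show ?thesis by (simp add: elem_coeff_eq_card)
qed


section \<open>Unitriangular systems over the integers\<close>

text \<open>Substitution along \<open>r\<close>: the equation at \<open>b\<close> determines
  \<open>c b\<close> from the values of smaller rank, and the unit diagonal avoids any
  division.\<close>

lemma unitriangular_solve:
  fixes M :: "'a \<Rightarrow> 'a \<Rightarrow> int" and r :: "'a \<Rightarrow> nat"
  assumes "finite P" and diag: "\<And>a. a \<in> P \<Longrightarrow> M a a = 1"
    and tri: "\<And>a b. a \<in> P \<Longrightarrow> b \<in> P \<Longrightarrow> M a b \<noteq> 0 \<Longrightarrow> b = a \<or> r a < r b"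
  shows "\<exists>!c. (\<forall>a. a \<notin> P \<longrightarrow> c a = 0) \<and> (\<forall>b\<in>P. (\<Sum>a\<in>P. c a * M a b) = f b)"
proof -
  have split: "(\<Sum>a\<in>P. c a * M a b) = c b + (\<Sum>a\<in>{a\<in>P. r a < r b}. c a * M a b)"
    if b: "b \<in> P" for c b
  proof -
    have "(\<Sum>a\<in>P. c a * M a b) = (\<Sum>a\<in>insert b {a\<in>P. r a < r b}. c a * M a b)"
      by (rule sum.mono_neutral_right) (use assms b in auto)
    then show ?thesis using \<open>finite P\<close> diag b by simp
  qed
  have "\<exists>c. (\<forall>a. a \<notin> P \<longrightarrow> c a = 0) \<and> (\<forall>b\<in>P. r b < k \<longrightarrow> (\<Sum>a\<in>P. c a * M a b) = f b)" for k
  proof (induction k)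
    case 0
    then show ?case by (intro exI[of _ "\<lambda>_. 0"]) simp
  next
    case (Suc k)
    then obtain c where c: "\<And>a. a \<notin> P \<Longrightarrow> c a = 0"
      "\<And>b. b \<in> P \<Longrightarrow> r b < k \<Longrightarrow> (\<Sum>a\<in>P. c a * M a b) = f b" by blast
    \<comment> \<open>Only entries of rank exactly \<open>k\<close> change; they do not occur in the
      equations of lower rank, which therefore stay solved.\<close>
    define c' where "c' b = (if b \<in> P \<and> r b = k
      then f b - (\<Sum>a\<in>{a\<in>P. r a < r b}. c a * M a b) else c b)" for b
    have low: "(\<Sum>a\<in>{a\<in>P. r a < r b}. c' a * M a b) = (\<Sum>a\<in>{a\<in>P. r a < r b}. c a * M a b)"
      if "r b \<le> k" for b
      using that by (intro sum.cong) (auto simp: c'_def)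
    have "(\<Sum>a\<in>P. c' a * M a b) = f b" if b: "b \<in> P" "r b < Suc k" for b
    proof (cases "r b = k")
      case True
      then show ?thesis using split[OF b(1), of c'] low[of b] b by (simp add: c'_def)
    next
      case False
      then have "r b < k" using b by simp
      moreover have "c' b = c b" using False by (simp add: c'_def)
      ultimately show ?thesis
        using split[OF b(1), of c'] split[OF b(1), of c] low[of b] c(2)[OF b(1)] by simp
    qed
    moreover have "c' a = 0" if "a \<notin> P" for a using that c(1) by (simp add: c'_def)
    ultimately show ?case by blast
  qed
  from this[of "Suc (Max (r ` P))"] obtain c where c: "\<And>a. a \<notin> P \<Longrightarrow> c a = 0"
    "\<And>b. b \<in> P \<Longrightarrow> r b < Suc (Max (r ` P)) \<Longrightarrow> (\<Sum>a\<in>P. c a * M a b) = f b" by blast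
  have "r b < Suc (Max (r ` P))" if "b \<in> P" for b
    using that \<open>finite P\<close> by (simp add: le_imp_less_Suc)
  then have ex: "(\<forall>a. a \<notin> P \<longrightarrow> c a = 0) \<and> (\<forall>b\<in>P. (\<Sum>a\<in>P. c a * M a b) = f b)"
    using c by blast
  show ?thesis
  proof (intro ex1I[where a = c])
    show "(\<forall>a. a \<notin> P \<longrightarrow> c a = 0) \<and> (\<forall>b\<in>P. (\<Sum>a\<in>P. c a * M a b) = f b)"
      by (fact ex)
  next
    fix d
    assume d: "(\<forall>a. a \<notin> P \<longrightarrow> d a = 0) \<and> (\<forall>b\<in>P. (\<Sum>a\<in>P. d a * M a b) = f b)"
    have "d b = c b" for b
    proof (induction "r b" arbitrary: b rule: less_induct)
      case less
      show ?case
      proof (cases "b \<in> P")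
        case True
        have "(\<Sum>a\<in>{a\<in>P. r a < r b}. d a * M a b) = (\<Sum>a\<in>{a\<in>P. r a < r b}. c a * M a b)"
          using less by (intro sum.cong) auto
        then show ?thesis using split[OF True, of c] split[OF True, of d] d ex True by simp
      next
        case False
        then show ?thesis using d ex by simp
      qed
    qed
    then show "d = c" by (rule ext)
  qed
qed

lemma finite_partitions: "finite (partitions n)"
proof (rule finite_subset)
  show "partitions n \<subseteq> {\<mu>. set \<mu> \<subseteq> {..n} \<and> length \<mu> \<le> n}"
  proof
    fix \<mu> assume \<mu>: "\<mu> \<in> partitions n"
    have "length \<mu> \<le> sum_list \<mu>" if "\<forall>x\<in>set \<mu>. 0 < x" for \<mu> :: "nat list"
      using that by (induction \<mu>) auto
    then show "\<mu> \<in> {\<mu>. set \<mu> \<subseteq> {..n} \<and> length \<mu> \<le> n}"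
      using \<mu> by (auto simp: partitions_def member_le_sum_list)
  qed
qed (simp add: finite_lists_length_le)

section \<open>Symmetry and reduction to conjugates of partitions\<close>

text \<open>Composing with \<open>\<sigma>\<close> turns a colouring of content
  \<open>\<alpha> \<circ> \<sigma>\<close> into one of content \<open>\<alpha>\<close>, and
  \<open>inv \<sigma>\<close> undoes this.\<close>

lemma chrom_coeff_permute:
  assumes "bij \<sigma>"
  shows "chrom_coeff V E (\<alpha> \<circ> \<sigma>) = chrom_coeff V E \<alpha>"
proof -
  define T where "T \<alpha> = {\<kappa> \<in> proper_colorings V E. \<forall>i. card {v \<in> V. \<kappa> v = i} = \<alpha> i}" for \<alpha>
  \<comment> \<open>Colourings are extensional functions, hence the value \<open>undefined\<close>
    off \<open>V\<close>.\<close>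
  define h where "h f \<kappa> = (\<lambda>v. if v \<in> V then f (\<kappa> v) else undefined)" for f :: "nat \<Rightarrow> nat" and \<kappa> :: "'a \<Rightarrow> nat"
  have inv: "bij (inv \<sigma>)" using assms by (rule bij_imp_bij_inv)
  have H: "h f \<kappa> \<in> T \<alpha>" if f: "bij f" and \<kappa>: "\<kappa> \<in> T (\<alpha> \<circ> f)" for f \<kappa> \<alpha>
  proof -
    have inj: "f a = f b \<longleftrightarrow> a = b" for a b using f by (meson bij_is_inj inj_eq)
    have "card {v \<in> V. h f \<kappa> v = i} = \<alpha> i" for i
    proof -
      obtain j where j: "i = f j" using f by (metis bij_pointE)
      have "{v \<in> V. h f \<kappa> v = i} = {v \<in> V. \<kappa> v = j}"
        using j by (auto simp: h_def inj)
      then show ?thesis using \<kappa> j by (simp add: T_def)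
    qed
    moreover have "h f \<kappa> \<in> proper_colorings V E"
      using \<kappa> by (auto simp: T_def h_def proper_colorings_def inj PiE_def extensional_def)
    ultimately show ?thesis by (simp add: T_def)
  qed
  have "bij_betw (h \<sigma>) (T (\<alpha> \<circ> \<sigma>)) (T \<alpha>)"
  proof (rule bij_betwI[where g = "h (inv \<sigma>)"])
    show "h \<sigma> \<in> T (\<alpha> \<circ> \<sigma>) \<rightarrow> T \<alpha>" using H[OF assms] by blast
    have "\<alpha> \<circ> \<sigma> \<circ> inv \<sigma> = \<alpha>" using assms by (simp add: fun_eq_iff bij_is_surj surj_f_inv_f)
    then show "h (inv \<sigma>) \<in> T \<alpha> \<rightarrow> T (\<alpha> \<circ> \<sigma>)" using H[OF inv, of _ "\<alpha> \<circ> \<sigma>"] by auto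
  qed (use assms in \<open>auto simp: h_def T_def proper_colorings_def fun_eq_iff PiE_def extensional_def
        bij_is_inj bij_is_surj surj_f_inv_f\<close>)
  then show ?thesis by (simp add: chrom_coeff_def T_def bij_betw_same_card)
qed

lemma elem_coeff_permute:
  assumes "bij \<sigma>"
  shows "elem_coeff \<mu> (\<alpha> \<circ> \<sigma>) = elem_coeff \<mu> \<alpha>"
proof -
  have inv: "bij (inv \<sigma>)" using assms by (rule bij_imp_bij_inv)
  have H: "map ((`) f) Ss \<in> elem_tuples \<mu> \<alpha>" if f: "bij f" and Ss: "Ss \<in> elem_tuples \<mu> (\<alpha> \<circ> f)" for f Ss \<alpha>
  proof -
    have inj: "f a = f b \<longleftrightarrow> a = b" for a b using f by (meson bij_is_inj inj_eq)
    have "\<alpha> i = card {k. k < length \<mu> \<and> i \<in> map ((`) f) Ss ! k}" for i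
    proof -
      obtain j where j: "i = f j" using f by (metis bij_pointE)
      have "{k. k < length \<mu> \<and> i \<in> map ((`) f) Ss ! k} = {k. k < length \<mu> \<and> j \<in> Ss ! k}"
        using j Ss by (auto simp: elem_tuples_def inj)
      then show ?thesis using Ss j by (simp add: elem_tuples_def)
    qed
    moreover have "card (f ` S) = card S" for S
      using f by (meson bij_is_inj card_image inj_on_subset subset_UNIV)
    ultimately show ?thesis using Ss by (simp add: elem_tuples_def)
  qed
  have "bij_betw (map ((`) \<sigma>)) (elem_tuples \<mu> (\<alpha> \<circ> \<sigma>)) (elem_tuples \<mu> \<alpha>)"
  proof (rule bij_betwI[where g = "map ((`) (inv \<sigma>))"])
    show "map ((`) \<sigma>) \<in> elem_tuples \<mu> (\<alpha> \<circ> \<sigma>) \<rightarrow> elem_tuples \<mu> \<alpha>" using H[OF assms] by blast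
    have "\<alpha> \<circ> \<sigma> \<circ> inv \<sigma> = \<alpha>" using assms by (simp add: fun_eq_iff bij_is_surj surj_f_inv_f)
    then show "map ((`) (inv \<sigma>)) \<in> elem_tuples \<mu> \<alpha> \<rightarrow> elem_tuples \<mu> (\<alpha> \<circ> \<sigma>)"
      using H[OF inv, of _ "\<alpha> \<circ> \<sigma>"] by auto
  qed (use assms in \<open>simp_all add: comp_def image_image bij_is_inj bij_is_surj surj_f_inv_f\<close>)
  then show ?thesis by (simp add: elem_coeff_eq_card bij_betw_same_card)
qed

text \<open>Sorting the exponents in decreasing order gives a partition, and \<open>\<mu>\<close> is
  its conjugate. Symmetric families of coefficients thus need to be compared at conjugates of
  partitions only.\<close>

lemma conjugate_exists:
  fixes \<alpha> :: "nat \<Rightarrow> nat"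
  assumes \<alpha>: "\<And>j. N \<le> j \<Longrightarrow> \<alpha> j = 0" and n: "(\<Sum>j<N. \<alpha> j) = n"
  obtains \<mu> \<sigma> where "\<mu> \<in> partitions n" "bij \<sigma>" "\<alpha> \<circ> \<sigma> = conjugate \<mu>"
proof -
  define M where "M = Max (\<alpha> ` {..N})"
  have M: "\<alpha> j \<le> M" for j
  proof (cases "j \<le> N")
    case True then show ?thesis unfolding M_def by (intro Max_ge) auto
  next
    case False
    then have "\<alpha> j = \<alpha> N" using \<alpha> by simp
    then show ?thesis unfolding M_def by (intro Max_ge) auto
  qed
  \<comment> \<open>Sorting is ascending, hence the reversed key; the bound \<open>M\<close> keeps
    truncated subtraction order-reversing.\<close>
  define xs where "xs = sort_key (\<lambda>j. M - \<alpha> j) [0..<N]"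
  have xs: "set xs = {..<N}" "distinct xs" "length xs = N" by (auto simp: xs_def)
  have srt: "sorted (map (\<lambda>j. M - \<alpha> j) xs)" by (simp add: xs_def)
  define \<sigma> where "\<sigma> j = (if j < N then xs ! j else j)" for j
  have bij_low: "bij_betw \<sigma> {..<N} {..<N}"
  proof -
    have "bij_betw ((!) xs) {..<N} {..<N}" using bij_betw_nth[OF xs(2)] xs by simp
    then show ?thesis by (rule bij_betw_cong[THEN iffD1, rotated]) (simp add: \<sigma>_def)
  qed
  have bij: "bij \<sigma>"
  proof -
    note bij_low
    moreover have "bij_betw \<sigma> {N..} {N..}"
      by (rule bij_betwI[where g = id]) (auto simp: \<sigma>_def)
    ultimately have "bij_betw \<sigma> ({..<N} \<union> {N..}) ({..<N} \<union> {N..})"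
      by (rule bij_betw_combine) auto
    moreover have "{..<N} \<union> {N..} = UNIV" by auto
    ultimately show ?thesis by simp
  qed
  have dec: "\<alpha> (\<sigma> k) \<le> \<alpha> (\<sigma> j)" if "j \<le> k" for j k
  proof (cases "k < N")
    case True
    then have "M - \<alpha> (xs ! j) \<le> M - \<alpha> (xs ! k)"
      using sorted_nth_mono[OF srt that] xs that by simp
    then have "\<alpha> (xs ! k) \<le> \<alpha> (xs ! j)" using M[of "xs ! j"] M[of "xs ! k"] by arith
    then show ?thesis using True that by (simp add: \<sigma>_def)
  next
    case False
    then show ?thesis by (simp add: \<sigma>_def \<alpha>)
  qed
  define \<mu> where "\<mu> = map (\<lambda>i. card {j. i < \<alpha> (\<sigma> j)}) [0..<\<alpha> (\<sigma> 0)]"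
  have fin: "finite {j. i < \<alpha> (\<sigma> j)}" for i
  proof (rule finite_subset[of _ "{..<N}"])
    have "\<alpha> (\<sigma> j) = 0" if "\<not> j < N" for j using that by (simp add: \<sigma>_def \<alpha>)
    then show "{j. i < \<alpha> (\<sigma> j)} \<subseteq> {..<N}" by fastforce
  qed simp
  \<comment> \<open>As \<open>\<alpha> \<circ> \<sigma>\<close> decreases, its superlevel sets are
    initial segments, determined by their sizes: the symmetry of the Young diagram.\<close>
  have init: "j < card {j. i < \<alpha> (\<sigma> j)} \<longleftrightarrow> i < \<alpha> (\<sigma> j)" for i j
  proof
    assume "i < \<alpha> (\<sigma> j)"
    then have "{..j} \<subseteq> {j. i < \<alpha> (\<sigma> j)}" by (auto intro: less_le_trans dec)
    then have "card {..j} \<le> card {j. i < \<alpha> (\<sigma> j)}" using fin card_mono by blast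
    then show "j < card {j. i < \<alpha> (\<sigma> j)}" by simp
  next
    assume *: "j < card {j. i < \<alpha> (\<sigma> j)}"
    show "i < \<alpha> (\<sigma> j)"
    proof (rule ccontr)
      assume "\<not> i < \<alpha> (\<sigma> j)"
      then have "k < j" if "i < \<alpha> (\<sigma> k)" for k
        using dec[of j k] that by (cases "j \<le> k") auto
      then have "{j. i < \<alpha> (\<sigma> j)} \<subseteq> {..<j}" by auto
      then have "card {j. i < \<alpha> (\<sigma> j)} \<le> card {..<j}" by (intro card_mono) auto
      then show False using * by simp
    qed
  qed
  have conj: "conjugate \<mu> j = \<alpha> (\<sigma> j)" for j
  proof -
    have "{i. i < length \<mu> \<and> j < \<mu> ! i} = {..<\<alpha> (\<sigma> j)}"
      using dec[of 0 j] by (auto simp: \<mu>_def init)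
    then show ?thesis by (simp add: conjugate_def)
  qed
  have "sum_list \<mu> = n"
  proof -
    \<comment> \<open>This range covers the supports of both \<open>conjugate \<mu>\<close> and
      \<open>\<alpha> \<circ> \<sigma>\<close>.\<close>
    have "sum_list \<mu> = (\<Sum>j<sum_list \<mu> + N. conjugate \<mu> j)"
      by (rule tuple_weight(1)[OF initial_tuple, symmetric]) (simp add: conjugate_eq_0)
    also have "\<dots> = (\<Sum>j<sum_list \<mu> + N. \<alpha> (\<sigma> j))" by (simp add: conj)
    also have "\<dots> = (\<Sum>j<N. \<alpha> (\<sigma> j))"
      by (rule sum.mono_neutral_right) (auto simp: \<sigma>_def \<alpha>)
    also have "\<dots> = (\<Sum>j<N. \<alpha> j)"
      by (rule sum.reindex_bij_betw[OF bij_low])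
    finally show ?thesis using n by simp
  qed
  moreover have "sorted_wrt (\<ge>) \<mu>"
    by (auto simp: \<mu>_def sorted_wrt_iff_nth_less intro!: card_mono fin)
  moreover have "\<forall>x\<in>set \<mu>. 0 < x"
    using init[of 0] by (auto simp: \<mu>_def)
  ultimately have "\<mu> \<in> partitions n" by (simp add: partitions_def)
  then show ?thesis using that bij conj by (metis comp_def fun_eq_iff)
qed

text \<open>Homogeneity of e_\<mu>; together with its counterpart for colourings it makes both sides
  of an expansion vanish at all exponents of another degree or of infinite support.\<close>

lemma elem_coeff_support:
  assumes "elem_coeff \<mu> \<alpha> \<noteq> 0"
  obtains N where "\<And>j. N \<le> j \<Longrightarrow> \<alpha> j = 0" "(\<Sum>j<N. \<alpha> j) = sum_list \<mu>"
proof -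
  obtain Ss where Ss: "Ss \<in> elem_tuples \<mu> \<alpha>"
    using assms by (cases "elem_tuples \<mu> \<alpha> = {}") (auto simp: elem_coeff_eq_card)
  have fin: "finite (\<Union>i<length \<mu>. Ss ! i)" using Ss by (auto simp: elem_tuples_def)
  then obtain N where N: "(\<Union>i<length \<mu>. Ss ! i) \<subseteq> {..<N}"
    by (meson finite_nat_iff_bounded)
  have "\<alpha> j = 0" if "N \<le> j" for j
  proof -
    have "{i. i < length \<mu> \<and> j \<in> Ss ! i} = {}" using N that by fastforce
    then show ?thesis using Ss by (simp add: elem_tuples_def)
  qed
  then show ?thesis using that tuple_weight(1)[OF Ss] by blast
qed

lemma chrom_coeff_support:
  assumes "chrom_coeff V E \<alpha> \<noteq> 0" "finite V"
  obtains N where "\<And>j. N \<le> j \<Longrightarrow> \<alpha> j = 0" "(\<Sum>j<N. \<alpha> j) = card V"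
proof -
  obtain \<kappa> where \<kappa>: "\<And>i. card {v \<in> V. \<kappa> v = i} = \<alpha> i"
  proof -
    have "{\<kappa> \<in> proper_colorings V E. \<forall>i. card {v \<in> V. \<kappa> v = i} = \<alpha> i} \<noteq> {}"
      using assms(1) unfolding chrom_coeff_def by (metis card.empty of_nat_0)
    then show ?thesis using that by blast
  qed
  obtain N where N: "\<kappa> ` V \<subseteq> {..<N}"
    using assms(2) by (meson finite_imageI finite_nat_iff_bounded)
  have "\<alpha> j = 0" if "N \<le> j" for j
  proof -
    have "{v \<in> V. \<kappa> v = j} = {}" using N that by fastforce
    then show ?thesis unfolding \<kappa>[symmetric] by (simp only: card.empty)
  qed
  moreover have "(\<Sum>j<N. \<alpha> j) = card V"
    using sum.group[OF assms(2) finite_lessThan N, of "\<lambda>_. 1::nat"] by (simp add: \<kappa>)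
  ultimately show ?thesis using that by blast
qed

text \<open>Both sides are symmetric and homogeneous, so the expansion is equivalent to its
  equations at conjugates of partitions, a unitriangular system. This justifies the
  \<open>THE\<close> in \<open>e_coeff\<close>.\<close>

lemma e_expansion_unique_existence:
  assumes "finite V"
  shows "\<exists>!c. is_e_expansion V E c"
proof -
  let ?P = "partitions (card V)"
  have "is_e_expansion V E c \<longleftrightarrow> (\<forall>\<mu>. \<mu> \<notin> ?P \<longrightarrow> c \<mu> = 0) \<and>
     (\<forall>\<nu>\<in>?P. (\<Sum>\<mu>\<in>?P. c \<mu> * elem_coeff \<mu> (conjugate \<nu>)) = chrom_coeff V E (conjugate \<nu>))" for c
  proof (intro iffI conjI allI)
    fix \<alpha>
    assume c: "(\<forall>\<mu>. \<mu> \<notin> ?P \<longrightarrow> c \<mu> = 0) \<and>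
     (\<forall>\<nu>\<in>?P. (\<Sum>\<mu>\<in>?P. c \<mu> * elem_coeff \<mu> (conjugate \<nu>)) = chrom_coeff V E (conjugate \<nu>))"
    have "chrom_coeff V E \<alpha> = (\<Sum>\<mu>\<in>?P. c \<mu> * elem_coeff \<mu> \<alpha>)" for \<alpha>
    proof (cases "\<exists>N. (\<forall>j\<ge>N. \<alpha> j = 0) \<and> (\<Sum>j<N. \<alpha> j) = card V")
      case True
      then obtain N where "\<And>j. N \<le> j \<Longrightarrow> \<alpha> j = 0" "(\<Sum>j<N. \<alpha> j) = card V" by blast
      then obtain \<nu> \<sigma> where "\<nu> \<in> ?P" and \<sigma>: "bij \<sigma>" "\<alpha> \<circ> \<sigma> = conjugate \<nu>"
        by (rule conjugate_exists)
      have "(\<Sum>\<mu>\<in>?P. c \<mu> * elem_coeff \<mu> (\<alpha> \<circ> \<sigma>)) = chrom_coeff V E (\<alpha> \<circ> \<sigma>)"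
        using c \<open>\<nu> \<in> ?P\<close> unfolding \<sigma>(2) by blast
      then show ?thesis using \<sigma>(1) by (simp add: chrom_coeff_permute elem_coeff_permute)
    next
      case False
      have "chrom_coeff V E \<alpha> = 0" using False chrom_coeff_support[OF _ assms] by metis
      moreover have "elem_coeff \<mu> \<alpha> = 0" if "\<mu> \<in> ?P" for \<mu>
      proof -
        have "sum_list \<mu> = card V" using that by (simp add: partitions_def)
        then show ?thesis using False elem_coeff_support by metis
      qed
      ultimately show ?thesis by simp
    qed
    then show "is_e_expansion V E c" using c by (simp add: is_e_expansion_def)
  qed (auto simp: is_e_expansion_def)
  moreover have "\<exists>!c. (\<forall>\<mu>. \<mu> \<notin> ?P \<longrightarrow> c \<mu> = 0) \<and>
     (\<forall>\<nu>\<in>?P. (\<Sum>\<mu>\<in>?P. c \<mu> * elem_coeff \<mu> (conjugate \<nu>)) = chrom_coeff V E (conjugate \<nu>))"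
    by (rule unitriangular_solve[of _ _ rank])
      (auto simp: finite_partitions elem_coeff_diag dest: elem_coeff_triangular)
  ultimately show ?thesis by simp
qed

lemma is_e_expansion_e_coeff:
  assumes "finite V"
  shows "is_e_expansion V E (e_coeff V E)"
proof -
  have "e_coeff V E = (THE c. is_e_expansion V E c)" by (simp add: e_coeff_def fun_eq_iff)
  then show ?thesis using theI'[OF e_expansion_unique_existence[OF assms]] by simp
qed


section \<open>Evaluation at a point\<close>

definition esym :: "nat \<Rightarrow> (nat \<Rightarrow> 'a::comm_ring_1) \<Rightarrow> nat \<Rightarrow> 'a" where
  "esym N x k = (\<Sum>S | S \<subseteq> {..<N} \<and> card S = k. \<Prod>j\<in>S. x j)"

text \<open>The generating polynomial of the elementary symmetric functions; in the induction a
  subset either avoids \<open>N\<close> or arises by inserting it. Choosing a point thus becomes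
  choosing a polynomial.\<close>

lemma coeff_prod_linear: "poly.coeff (\<Prod>j<N. [:1, x j:]) k = esym N x k"
proof (induction N arbitrary: k)
  case 0
  have "{S :: nat set. S = {} \<and> card S = k} = (if k = 0 then {{}} else {})" by auto
  then show ?case by (simp add: esym_def)
next
  case (Suc N)
  show ?case
  proof (cases k)
    case 0
    have "{S. S \<subseteq> {..<M} \<and> card S = 0} = {{}}" for M :: nat
      using finite_subset by fastforce
    then show ?thesis using Suc.IH[of 0] 0 by (simp add: esym_def coeff_mult)
  next
    case (Suc m)
    let ?A = "\<lambda>M k. {S. S \<subseteq> {..<M} \<and> card S = k} :: nat set set"
    have fin: "finite S" if "S \<subseteq> {..<M}" for S and M :: nat using that finite_subset by blast
    have split: "?A (Suc N) k = ?A N k \<union> insert N ` ?A N m"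
    proof (intro equalityI subsetI)
      fix S assume S: "S \<in> ?A (Suc N) k"
      show "S \<in> ?A N k \<union> insert N ` ?A N m"
      proof (cases "N \<in> S")
        case True
        then have "S = insert N (S - {N})" "S - {N} \<in> ?A N m"
          using S fin[of S] Suc by (auto simp: lessThan_Suc)
        then show ?thesis by blast
      next
        case False
        then show ?thesis using S by (auto simp: lessThan_Suc)
      qed
    next
      fix S assume "S \<in> ?A N k \<union> insert N ` ?A N m"
      moreover have "card (insert N T) = Suc (card T)" if "T \<subseteq> {..<N}" for T
        using that fin by (intro card_insert_disjoint) auto
      ultimately show "S \<in> ?A (Suc N) k" using Suc by (auto simp: lessThan_Suc)
    qed
    have "esym (Suc N) x k = esym N x k + (\<Sum>S\<in>insert N ` ?A N m. \<Prod>j\<in>S. x j)"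
      unfolding esym_def split by (rule sum.union_disjoint) (auto intro: rev_finite_subset[of "Pow {..<N}"])
    also have "(\<Sum>S\<in>insert N ` ?A N m. \<Prod>j\<in>S. x j) = (\<Sum>S\<in>?A N m. \<Prod>j\<in>insert N S. x j)"
      by (rule sum.reindex_cong[OF _ refl refl]) (auto simp: inj_on_def insert_eq_iff)
    also have "\<dots> = (\<Sum>S\<in>?A N m. x N * (\<Prod>j\<in>S. x j))"
      using fin by (intro sum.cong refl prod.insert) auto
    also have "\<dots> = x N * esym N x m" by (simp add: esym_def sum_distrib_left)
    finally show ?thesis using Suc.IH[of k] Suc.IH[of m] Suc by (simp add: mult.commute)
  qed
qed

definition monomial :: "nat \<Rightarrow> (nat \<Rightarrow> 'a::comm_ring_1) \<Rightarrow> (nat \<Rightarrow> nat) \<Rightarrow> 'a" where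
  "monomial N x \<alpha> = (\<Prod>j<N. x j ^ \<alpha> j)"

definition exponents :: "nat \<Rightarrow> nat \<Rightarrow> (nat \<Rightarrow> nat) set" where
  "exponents N n = {\<alpha>. (\<forall>j\<ge>N. \<alpha> j = 0) \<and> (\<Sum>j<N. \<alpha> j) = n}"

lemma finite_exponents: "finite (exponents N n)"
proof (rule finite_subset)
  show "exponents N n \<subseteq> (\<lambda>f j. if j < N then f j else 0) ` ({..<N} \<rightarrow>\<^sub>E {..n})"
  proof
    fix \<alpha> assume \<alpha>: "\<alpha> \<in> exponents N n"
    have "\<alpha> j \<le> n" if "j < N" for j
      using member_le_sum[of j "{..<N}" \<alpha>] that \<alpha> by (auto simp: exponents_def)
    then have "restrict \<alpha> {..<N} \<in> {..<N} \<rightarrow>\<^sub>E {..n}" by auto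
    moreover have "\<alpha> = (\<lambda>j. if j < N then restrict \<alpha> {..<N} j else 0)"
      using \<alpha> by (auto simp: exponents_def)
    ultimately show "\<alpha> \<in> (\<lambda>f j. if j < N then f j else 0) ` ({..<N} \<rightarrow>\<^sub>E {..n})" by blast
  qed
qed (simp add: finite_PiE)

abbreviation bounded_colorings :: "'b set \<Rightarrow> ('b \<Rightarrow> 'b \<Rightarrow> bool) \<Rightarrow> nat \<Rightarrow> ('b \<Rightarrow> nat) set" where
  "bounded_colorings V E N \<equiv> proper_colorings V E \<inter> (V \<rightarrow>\<^sub>E {..<N})"

text \<open>Colourings are grouped by the sizes of their colour classes. Allowing only colours below
  \<open>N\<close> amounts to setting the other variables to 0.\<close>

lemma sum_colorings_eq_chrom_coeff:
  fixes x :: "nat \<Rightarrow> 'a::comm_ring_1"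
  assumes "finite V"
  shows "(\<Sum>\<kappa>\<in>bounded_colorings V E N. \<Prod>v\<in>V. x (\<kappa> v)) =
    (\<Sum>\<alpha>\<in>exponents N (card V). of_int (chrom_coeff V E \<alpha>) * monomial N x \<alpha>)"
proof -
  let ?K = "bounded_colorings V E N"
  define content where "content \<kappa> i = card {v \<in> V. \<kappa> v = i}" for \<kappa> :: "'b \<Rightarrow> nat" and i
  have "finite ?K" using assms by (simp add: finite_PiE)
  have image: "\<kappa> ` V \<subseteq> {..<N}" if "\<kappa> \<in> ?K" for \<kappa> using that by auto
  have "content ` ?K \<subseteq> exponents N (card V)"
  proof
    fix \<alpha> assume "\<alpha> \<in> content ` ?K"
    then obtain \<kappa> where \<kappa>: "\<kappa> \<in> ?K" "\<alpha> = content \<kappa>" by blast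
    have "content \<kappa> j = 0" if "N \<le> j" for j
    proof -
      have "{v \<in> V. \<kappa> v = j} = {}" using image[OF \<kappa>(1)] that by fastforce
      then show ?thesis unfolding content_def by (simp only: card.empty)
    qed
    moreover have "(\<Sum>j<N. content \<kappa> j) = card V"
      using sum.group[OF assms finite_lessThan image[OF \<kappa>(1)], of "\<lambda>_. 1::nat"]
      by (simp add: content_def)
    ultimately show "\<alpha> \<in> exponents N (card V)"
      by (simp add: exponents_def \<kappa>(2))
  qed
  then have "(\<Sum>\<kappa>\<in>?K. \<Prod>v\<in>V. x (\<kappa> v)) =
      (\<Sum>\<alpha>\<in>exponents N (card V). \<Sum>\<kappa>\<in>{\<kappa>\<in>?K. content \<kappa> = \<alpha>}. \<Prod>v\<in>V. x (\<kappa> v))"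
    by (rule sum.group[OF \<open>finite ?K\<close> finite_exponents, symmetric])
  also have "\<dots> = (\<Sum>\<alpha>\<in>exponents N (card V). of_int (chrom_coeff V E \<alpha>) * monomial N x \<alpha>)"
  proof (rule sum.cong[OF refl])
    fix \<alpha> assume \<alpha>: "\<alpha> \<in> exponents N (card V)"
    have "(\<Prod>v\<in>V. x (\<kappa> v)) = monomial N x \<alpha>" if \<kappa>: "\<kappa> \<in> {\<kappa>\<in>?K. content \<kappa> = \<alpha>}" for \<kappa>
    proof -
      have "(\<Prod>v\<in>V. x (\<kappa> v)) = (\<Prod>j<N. \<Prod>v\<in>{v\<in>V. \<kappa> v = j}. x (\<kappa> v))"
        using \<kappa> image by (intro prod.group[symmetric] assms) auto
      also have "\<dots> = (\<Prod>j<N. \<Prod>v\<in>{v\<in>V. \<kappa> v = j}. x j)"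
        by (intro prod.cong) auto
      finally show ?thesis using \<kappa> by (auto simp: monomial_def content_def)
    qed
    moreover have "{\<kappa>\<in>?K. content \<kappa> = \<alpha>} = {\<kappa> \<in> proper_colorings V E. \<forall>i. card {v \<in> V. \<kappa> v = i} = \<alpha> i}"
    proof -
      \<comment> \<open>A colour from \<open>N\<close> on has exponent 0, but a used colour has a
        nonempty finite class.\<close>
      have "\<kappa> \<in> V \<rightarrow>\<^sub>E {..<N}" if "\<kappa> \<in> proper_colorings V E" "\<forall>i. card {v \<in> V. \<kappa> v = i} = \<alpha> i" for \<kappa>
      proof -
        have "\<kappa> v < N" if "v \<in> V" for v
        proof (rule ccontr)
          assume "\<not> \<kappa> v < N"
          then have "\<alpha> (\<kappa> v) = 0" using \<alpha> by (simp add: exponents_def)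
          then have "card {u \<in> V. \<kappa> u = \<kappa> v} = 0" using \<open>\<forall>i. _ i = \<alpha> i\<close> by simp
          then show False using that assms by auto
        qed
        then show ?thesis using that(1) by (auto simp: proper_colorings_def PiE_def)
      qed
      then show ?thesis by (auto simp: content_def fun_eq_iff)
    qed
    moreover have "(\<Sum>\<kappa>\<in>{\<kappa>\<in>?K. content \<kappa> = \<alpha>}. \<Prod>v\<in>V. x (\<kappa> v))
        = (\<Sum>\<kappa>\<in>{\<kappa>\<in>?K. content \<kappa> = \<alpha>}. monomial N x \<alpha>)"
      using calculation(1) by (rule sum.cong[OF refl])
    ultimately show "(\<Sum>\<kappa>\<in>{\<kappa>\<in>?K. content \<kappa> = \<alpha>}. \<Prod>v\<in>V. x (\<kappa> v))
        = of_int (chrom_coeff V E \<alpha>) * monomial N x \<alpha>"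
      by (simp only: chrom_coeff_def sum_constant of_int_of_nat_eq)
  qed
  finally show ?thesis .
qed

lemma prod_list_esym:
  "prod_list (map (esym N x) \<mu>) =
    (\<Sum>Ss | length Ss = length \<mu> \<and> (\<forall>i<length \<mu>. Ss ! i \<subseteq> {..<N} \<and> card (Ss ! i) = \<mu> ! i).
      \<Prod>i<length \<mu>. \<Prod>j\<in>Ss ! i. x j)"
proof (induction \<mu>)
  case Nil
  have "{Ss :: nat set list. Ss = []} = {[]}" by auto
  then show ?case by simp
next
  case (Cons m \<mu>)
  let ?T = "\<lambda>\<mu>. {Ss. length Ss = length \<mu> \<and> (\<forall>i<length \<mu>. Ss ! i \<subseteq> {..<N} \<and> card (Ss ! i) = \<mu> ! i)}"
  let ?A = "{S. S \<subseteq> {..<N} \<and> card S = m}"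
  have "?T (m # \<mu>) = (\<lambda>(S, Ss). S # Ss) ` (?A \<times> ?T \<mu>)"
  proof (intro equalityI subsetI)
    fix Ss assume Ss: "Ss \<in> ?T (m # \<mu>)"
    then obtain S Ss' where eq: "Ss = S # Ss'" by (cases Ss) auto
    have "\<forall>i<Suc (length \<mu>). Ss ! i \<subseteq> {..<N} \<and> card (Ss ! i) = (m # \<mu>) ! i" using Ss by simp
    from this[rule_format, of 0] have "S \<in> ?A" using eq by simp
    moreover have "Ss' \<in> ?T \<mu>" using Ss eq by fastforce
    ultimately show "Ss \<in> (\<lambda>(S, Ss). S # Ss) ` (?A \<times> ?T \<mu>)" using eq by auto
  next
    fix Ss assume "Ss \<in> (\<lambda>(S, Ss). S # Ss) ` (?A \<times> ?T \<mu>)"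
    then show "Ss \<in> ?T (m # \<mu>)" by (force simp: nth_Cons split: nat.splits)
  qed
  then have "(\<Sum>Ss\<in>?T (m # \<mu>). \<Prod>i<length (m # \<mu>). \<Prod>j\<in>Ss ! i. x j)
      = (\<Sum>p\<in>?A \<times> ?T \<mu>. \<Prod>i<length (m # \<mu>). \<Prod>j\<in>(case p of (S, Ss) \<Rightarrow> S # Ss) ! i. x j)"
    by (intro sum.reindex_cong[where l = "\<lambda>(S, Ss). S # Ss"]) (auto simp: inj_on_def)
  also have "\<dots> = (\<Sum>p\<in>?A \<times> ?T \<mu>. case p of (S, Ss) \<Rightarrow> (\<Prod>j\<in>S. x j) * (\<Prod>i<length \<mu>. \<Prod>j\<in>Ss ! i. x j))"
    by (intro sum.cong refl) (auto simp: prod.lessThan_Suc_shift simp del: prod.lessThan_Suc)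
  also have "\<dots> = esym N x m * prod_list (map (esym N x) \<mu>)"
    unfolding Cons.IH by (simp add: esym_def sum_product sum.cartesian_product)
  finally show ?case by simp
qed

text \<open>The tuples from the expanded product, grouped by content, are exactly those that
  \<open>elem_coeff\<close> counts.\<close>

lemma prod_list_esym_eq_elem_coeff:
  fixes x :: "nat \<Rightarrow> 'a::comm_ring_1"
  shows "prod_list (map (esym N x) \<mu>) =
    (\<Sum>\<alpha>\<in>exponents N (sum_list \<mu>). of_int (elem_coeff \<mu> \<alpha>) * monomial N x \<alpha>)"
proof -
  let ?T = "{Ss. length Ss = length \<mu> \<and> (\<forall>i<length \<mu>. Ss ! i \<subseteq> {..<N} \<and> card (Ss ! i) = \<mu> ! i)}"
  define content where "content Ss j = card {i. i < length \<mu> \<and> j \<in> Ss ! i}" for Ss :: "nat set list" and j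
  have tuple: "Ss \<in> elem_tuples \<mu> (content Ss)" if "Ss \<in> ?T" for Ss
    using that finite_subset by (auto simp: elem_tuples_def content_def)
  have "finite ?T"
    by (rule finite_subset[OF _ finite_lists_length_eq[of "Pow {..<N}" "length \<mu>"]])
      (auto simp: set_conv_nth subset_iff)
  moreover have "content ` ?T \<subseteq> exponents N (sum_list \<mu>)"
  proof
    fix \<alpha> assume "\<alpha> \<in> content ` ?T"
    then obtain Ss where Ss: "Ss \<in> ?T" "\<alpha> = content Ss" by blast
    have "content Ss j = 0" if "N \<le> j" for j
    proof -
      have "{i. i < length \<mu> \<and> j \<in> Ss ! i} = {}" using Ss(1) that by fastforce
      then show ?thesis unfolding content_def by (simp only: card.empty)
    qed
    then show "\<alpha> \<in> exponents N (sum_list \<mu>)"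
      using tuple_weight(1)[OF tuple[OF Ss(1)]] Ss(2) by (simp add: exponents_def)
  qed
  ultimately have "prod_list (map (esym N x) \<mu>) =
      (\<Sum>\<alpha>\<in>exponents N (sum_list \<mu>). \<Sum>Ss\<in>{Ss\<in>?T. content Ss = \<alpha>}. \<Prod>i<length \<mu>. \<Prod>j\<in>Ss ! i. x j)"
    unfolding prod_list_esym by (intro sum.group[symmetric] finite_exponents)
  also have "\<dots> = (\<Sum>\<alpha>\<in>exponents N (sum_list \<mu>). of_int (elem_coeff \<mu> \<alpha>) * monomial N x \<alpha>)"
  proof (rule sum.cong[OF refl])
    fix \<alpha> assume \<alpha>: "\<alpha> \<in> exponents N (sum_list \<mu>)"
    have "(\<Prod>i<length \<mu>. \<Prod>j\<in>Ss ! i. x j) = monomial N x \<alpha>" if Ss: "Ss \<in> {Ss\<in>?T. content Ss = \<alpha>}" for Ss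
    proof -
      have "(\<Prod>i<length \<mu>. \<Prod>j\<in>Ss ! i. x j) = (\<Prod>i<length \<mu>. \<Prod>j<N. if j \<in> Ss ! i then x j else 1)"
      proof (rule prod.cong[OF refl])
        fix i assume "i \<in> {..<length \<mu>}"
        then have "{j \<in> {..<N}. j \<in> Ss ! i} = Ss ! i" using Ss by auto
        then show "(\<Prod>j\<in>Ss ! i. x j) = (\<Prod>j<N. if j \<in> Ss ! i then x j else 1)"
          by (simp flip: prod.inter_filter)
      qed
      also have "\<dots> = (\<Prod>j<N. \<Prod>i<length \<mu>. if j \<in> Ss ! i then x j else 1)"
        by (rule prod.swap)
      also have "\<dots> = (\<Prod>j<N. x j ^ content Ss j)"
        by (simp add: content_def flip: prod.inter_filter)
      finally show ?thesis using Ss by (simp add: monomial_def)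
    qed
    moreover have "{Ss\<in>?T. content Ss = \<alpha>} = elem_tuples \<mu> \<alpha>"
    proof (intro equalityI subsetI)
      fix Ss assume "Ss \<in> elem_tuples \<mu> \<alpha>"
      moreover from this have "Ss ! i \<subseteq> {..<N}" if "i < length \<mu>" for i
        using tuple_weight(3) \<alpha> that by (simp add: exponents_def)
      ultimately show "Ss \<in> {Ss\<in>?T. content Ss = \<alpha>}"
        by (simp add: elem_tuples_def content_def fun_eq_iff)
    qed (use tuple in auto)
    ultimately have "(\<Sum>Ss\<in>{Ss\<in>?T. content Ss = \<alpha>}. \<Prod>i<length \<mu>. \<Prod>j\<in>Ss ! i. x j)
        = (\<Sum>Ss\<in>elem_tuples \<mu> \<alpha>. monomial N x \<alpha>)"
      by (metis (no_types, lifting) sum.cong)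
    then show "(\<Sum>Ss\<in>{Ss\<in>?T. content Ss = \<alpha>}. \<Prod>i<length \<mu>. \<Prod>j\<in>Ss ! i. x j)
        = of_int (elem_coeff \<mu> \<alpha>) * monomial N x \<alpha>"
      by (simp add: elem_coeff_eq_card)
  qed
  finally show ?thesis .
qed

text \<open>The working form of the expansion: the integer coefficients act on any commutative ring
  through \<open>of_int\<close>, so polynomial and complex points are both available.\<close>

lemma e_expansion_eval:
  fixes x :: "nat \<Rightarrow> 'a::comm_ring_1"
  assumes "finite V"
  shows "(\<Sum>\<kappa>\<in>bounded_colorings V E N. \<Prod>v\<in>V. x (\<kappa> v)) =
    (\<Sum>\<mu>\<in>partitions (card V). of_int (e_coeff V E \<mu>) * prod_list (map (esym N x) \<mu>))"
proof -
  let ?P = "partitions (card V)" and ?A = "exponents N (card V)"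
  have "(\<Sum>\<mu>\<in>?P. of_int (e_coeff V E \<mu>) * prod_list (map (esym N x) \<mu>))
      = (\<Sum>\<mu>\<in>?P. of_int (e_coeff V E \<mu>) * (\<Sum>\<alpha>\<in>?A. of_int (elem_coeff \<mu> \<alpha>) * monomial N x \<alpha>))"
    by (intro sum.cong refl) (simp add: prod_list_esym_eq_elem_coeff partitions_def)
  also have "\<dots> = (\<Sum>\<alpha>\<in>?A. of_int (\<Sum>\<mu>\<in>?P. e_coeff V E \<mu> * elem_coeff \<mu> \<alpha>) * monomial N x \<alpha>)"
    unfolding sum_distrib_left sum_distrib_right of_int_sum
    by (subst sum.swap) (simp add: mult.assoc)
  also have "\<dots> = (\<Sum>\<alpha>\<in>?A. of_int (chrom_coeff V E \<alpha>) * monomial N x \<alpha>)"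
    using is_e_expansion_e_coeff[OF assms, of E] by (simp add: is_e_expansion_def)
  finally show ?thesis by (simp add: sum_colorings_eq_chrom_coeff[OF assms])
qed


section \<open>Colourings of spiders\<close>

text \<open>The transfer operator of proper colouring: \<open>h\<close> is a function of the colour
  of a vertex, the result a function of the colour \<open>c\<close> of its neighbour.\<close>

definition walk_step :: "nat \<Rightarrow> (nat \<Rightarrow> 'a::comm_ring_1) \<Rightarrow> (nat \<Rightarrow> 'a) \<Rightarrow> nat \<Rightarrow> 'a" where
  "walk_step N x h c = (\<Sum>b\<in>{..<N} - {c}. x b * h b)"

text \<open>The weighted sum over the proper colourings of a leg with \<open>l\<close> vertices, given the colour of the
  centre.\<close>

definition leg_sum :: "nat \<Rightarrow> (nat \<Rightarrow> 'a::comm_ring_1) \<Rightarrow> nat \<Rightarrow> nat \<Rightarrow> 'a" where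
  "leg_sum N x l = (walk_step N x ^^ l) (\<lambda>_. 1)"

text \<open>A colouring of \<open>V\<close> extends to the pendant vertex \<open>u\<close> by every
  colour except that of \<open>w\<close>, so summing out the colour of \<open>u\<close> applies
  \<open>walk_step\<close> to \<open>h\<close>. The factor \<open>f\<close> ignores that colour and
  is carried along.\<close>

lemma sum_colorings_pendant:
  fixes x :: "nat \<Rightarrow> 'a::comm_ring_1"
  assumes V: "finite V" "u \<notin> V" "w \<in> V"
    and E: "\<And>a b. a \<in> V \<Longrightarrow> b \<in> V \<Longrightarrow> E' a b \<longleftrightarrow> E a b" "\<And>a. a \<in> V \<Longrightarrow> E' u a \<longleftrightarrow> a = w"
      "\<And>a. a \<in> V \<Longrightarrow> E' a u \<longleftrightarrow> a = w" "\<not> E' u u"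
    and f: "\<And>\<kappa> c. f (\<kappa>(u := c)) = f \<kappa>"
  shows "(\<Sum>\<kappa>\<in>bounded_colorings (insert u V) E' N. (\<Prod>v\<in>insert u V. x (\<kappa> v)) * (f \<kappa> * h (\<kappa> u))) =
    (\<Sum>\<kappa>\<in>bounded_colorings V E N. (\<Prod>v\<in>V. x (\<kappa> v)) * (f \<kappa> * walk_step N x h (\<kappa> w)))"
proof -
  let ?K = "bounded_colorings V E N"
  let ?S = "SIGMA \<kappa>:?K. {..<N} - {\<kappa> w}"
  have fin: "finite ?K" using V by (simp add: finite_PiE)
  have "(\<Sum>\<kappa>\<in>bounded_colorings (insert u V) E' N. (\<Prod>v\<in>insert u V. x (\<kappa> v)) * (f \<kappa> * h (\<kappa> u))) =
    (\<Sum>p\<in>?S. (\<Prod>v\<in>V. x (fst p v)) * (f (fst p) * (x (snd p) * h (snd p))))"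
  \<comment> \<open>A colouring corresponds to its restriction, made \<open>undefined\<close> at
    \<open>u\<close>, together with the colour of \<open>u\<close>.\<close>
  proof (rule sum.reindex_bij_witness[where i = "\<lambda>p. (fst p)(u := snd p)" and
        j = "\<lambda>\<kappa>. (\<kappa>(u := undefined), \<kappa> u)"])
    fix \<kappa> assume \<kappa>: "\<kappa> \<in> bounded_colorings (insert u V) E' N"
    show "(\<kappa>(u := undefined), \<kappa> u) \<in> ?S"
      using \<kappa> V E by (auto simp: proper_colorings_def PiE_def extensional_def)
    have "(\<Prod>v\<in>V. x ((\<kappa>(u := undefined)) v)) = (\<Prod>v\<in>V. x (\<kappa> v))"
      using V by (intro prod.cong) auto
    then show "(\<Prod>v\<in>V. x (fst (\<kappa>(u := undefined), \<kappa> u) v)) *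
        (f (fst (\<kappa>(u := undefined), \<kappa> u)) * (x (snd (\<kappa>(u := undefined), \<kappa> u)) * h (snd (\<kappa>(u := undefined), \<kappa> u)))) =
        (\<Prod>v\<in>insert u V. x (\<kappa> v)) * (f \<kappa> * h (\<kappa> u))"
      using V by (simp add: f mult_ac)
  next
    fix p assume p: "p \<in> ?S"
    then obtain \<kappa> c where pc: "p = (\<kappa>, c)" "\<kappa> \<in> ?K" "c < N" "c \<noteq> \<kappa> w" by auto
    have "(\<kappa>(u := c)) \<in> proper_colorings (insert u V) E'"
      using pc V E by (auto simp: proper_colorings_def PiE_def extensional_def)
    then show "(fst p)(u := snd p) \<in> bounded_colorings (insert u V) E' N"
      using pc by (auto simp: PiE_def extensional_def)
    have "\<kappa> u = undefined" using pc V by (auto simp: PiE_def extensional_def)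
    then show "(((fst p)(u := snd p))(u := undefined), ((fst p)(u := snd p)) u) = p"
      using pc by (simp add: fun_upd_idem)
  qed simp
  also have "\<dots> = (\<Sum>\<kappa>\<in>?K. \<Sum>c\<in>{..<N} - {\<kappa> w}. (\<Prod>v\<in>V. x (\<kappa> v)) * (f \<kappa> * (x c * h c)))"
    using fin by (simp add: sum.Sigma split_def)
  also have "\<dots> = (\<Sum>\<kappa>\<in>?K. (\<Prod>v\<in>V. x (\<kappa> v)) * (f \<kappa> * walk_step N x h (\<kappa> w)))"
    by (simp add: walk_step_def sum_distrib_left)
  finally show ?thesis .
qed

section \<open>Building a spider leg by leg and vertex by vertex\<close>

lemma spider_V_Nil: "spider_V [] = {(0, 0)}"
  by (auto simp: spider_V_def)

lemma spider_V_append: "spider_V (ls @ [l]) = spider_V ls \<union> {Suc (length ls)} \<times> {1..l}"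
proof (rule set_eqI)
  fix v :: "nat \<times> nat"
  obtain i j where v: "v = (i, j)" by (cases v)
  show "v \<in> spider_V (ls @ [l]) \<longleftrightarrow> v \<in> spider_V ls \<union> {Suc (length ls)} \<times> {1..l}"
  proof (cases "i = Suc (length ls)")
    case True
    then show ?thesis by (auto simp: v spider_V_def)
  next
    case False
    then have "i - 1 < length ls" if "1 \<le> i" "i \<le> Suc (length ls)" using that by auto
    then show ?thesis using False by (auto simp: v spider_V_def nth_append)
  qed
qed

text \<open>A leg of length 0 adds nothing, so a new leg can be grown from length 0 by pendant
  vertices.\<close>

lemma spider_V_append_0: "spider_V (ls @ [0]) = spider_V ls"
  by (simp add: spider_V_append)

lemma spider_E_append_0: "spider_E (ls @ [0]) = spider_E ls"
  by (simp add: spider_E_def spider_V_append_0 fun_eq_iff)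

lemma spider_V_append_Suc:
  "spider_V (ls @ [Suc l]) = insert (Suc (length ls), Suc l) (spider_V (ls @ [l]))"
  by (auto simp: spider_V_append atLeastAtMostSuc_conv)

lemma finite_card_spider_V: "finite (spider_V ls) \<and> card (spider_V ls) = Suc (sum_list ls)"
proof (induction ls rule: rev_induct)
  case Nil
  then show ?case by (simp add: spider_V_Nil)
next
  case (snoc l ls)
  show ?case
  proof (induction l)
    case 0
    then show ?case using snoc by (simp add: spider_V_append_0)
  next
    case (Suc l)
    have "(Suc (length ls), Suc l) \<notin> spider_V (ls @ [l])"
      by (simp add: spider_V_def)
    then show ?case using Suc by (simp add: spider_V_append_Suc)
  qed
qed

lemmas finite_spider_V = finite_card_spider_V[THEN conjunct1]
lemmas card_spider_V = finite_card_spider_V[THEN conjunct2]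

text \<open>The last leg is summed out from its tip inwards. \<open>h\<close> depends on the colour
  of the tip, which is the centre when \<open>l = 0\<close>; it is generalised because every step
  replaces it by \<open>walk_step N x h\<close>.\<close>

lemma sum_colorings_append_leg:
  fixes x :: "nat \<Rightarrow> 'a::comm_ring_1"
  shows "(\<Sum>\<kappa>\<in>bounded_colorings (spider_V (ls @ [l])) (spider_E (ls @ [l])) N.
      (\<Prod>v\<in>spider_V (ls @ [l]). x (\<kappa> v)) * (f (\<kappa> (0, 0)) * h (\<kappa> (if l = 0 then (0, 0) else (Suc (length ls), l))))) =
    (\<Sum>\<kappa>\<in>bounded_colorings (spider_V ls) (spider_E ls) N.
      (\<Prod>v\<in>spider_V ls. x (\<kappa> v)) * (f (\<kappa> (0, 0)) * (walk_step N x ^^ l) h (\<kappa> (0, 0))))"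
proof (induction l arbitrary: h)
  case 0
  then show ?case by (simp add: spider_V_append_0 spider_E_append_0)
next
  case (Suc l)
  let ?u = "(Suc (length ls), Suc l)" and ?w = "if l = 0 then (0, 0) else (Suc (length ls), l)"
  have "(\<Sum>\<kappa>\<in>bounded_colorings (insert ?u (spider_V (ls @ [l]))) (spider_E (ls @ [Suc l])) N.
      (\<Prod>v\<in>insert ?u (spider_V (ls @ [l])). x (\<kappa> v)) * (f (\<kappa> (0, 0)) * h (\<kappa> ?u))) =
    (\<Sum>\<kappa>\<in>bounded_colorings (spider_V (ls @ [l])) (spider_E (ls @ [l])) N.
      (\<Prod>v\<in>spider_V (ls @ [l]). x (\<kappa> v)) * (f (\<kappa> (0, 0)) * walk_step N x h (\<kappa> ?w)))"
  proof (rule sum_colorings_pendant)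
    show "spider_E (ls @ [Suc l]) a b \<longleftrightarrow> spider_E (ls @ [l]) a b"
      if "a \<in> spider_V (ls @ [l])" "b \<in> spider_V (ls @ [l])" for a b
      using that by (simp add: spider_E_def spider_V_append_Suc)
    have u: "spider_E (ls @ [Suc l]) ?u a \<longleftrightarrow> a = ?w" if "a \<in> spider_V (ls @ [l])" for a
      using that by (cases a) (auto simp: spider_E_def spider_V_append_Suc, auto simp: spider_V_def)
    then show "\<And>a. a \<in> spider_V (ls @ [l]) \<Longrightarrow> spider_E (ls @ [Suc l]) ?u a \<longleftrightarrow> a = ?w" .
    have "spider_E ls a b \<longleftrightarrow> spider_E ls b a" for ls a b by (auto simp: spider_E_def)
    then show "\<And>a. a \<in> spider_V (ls @ [l]) \<Longrightarrow> spider_E (ls @ [Suc l]) a ?u \<longleftrightarrow> a = ?w" using u by blast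
    show "\<not> spider_E (ls @ [Suc l]) ?u ?u" by (simp add: spider_E_def)
  qed (auto simp: finite_spider_V, auto simp: spider_V_def)
  then show ?case using Suc.IH[of "walk_step N x h"]
    by (simp add: spider_V_append_Suc funpow_swap1)
qed

text \<open>Given the colour of the centre the legs are independent; the weight \<open>f\<close>
  absorbs the factors of the legs already summed out.\<close>

lemma sum_colorings_spider_weighted:
  fixes x :: "nat \<Rightarrow> 'a::comm_ring_1"
  shows "(\<Sum>\<kappa>\<in>bounded_colorings (spider_V ls) (spider_E ls) N.
      (\<Prod>v\<in>spider_V ls. x (\<kappa> v)) * f (\<kappa> (0, 0))) =
    (\<Sum>c<N. x c * f c * (\<Prod>l\<leftarrow>ls. leg_sum N x l c))"
proof (induction ls arbitrary: f rule: rev_induct)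
  case Nil
  have "(\<Sum>\<kappa>\<in>bounded_colorings {(0, 0)} (spider_E []) N. x (\<kappa> (0, 0)) * f (\<kappa> (0, 0))) = (\<Sum>c<N. x c * f c)"
    by (rule sum.reindex_bij_witness[where i = "\<lambda>c. (\<lambda>v. undefined)((0, 0) := c)" and j = "\<lambda>\<kappa>. \<kappa> (0, 0)"])
      (auto simp: proper_colorings_def PiE_def extensional_def spider_E_def fun_eq_iff)
  then show ?case by (simp add: spider_V_Nil)
next
  case (snoc l ls)
  then show ?case
    using sum_colorings_append_leg[where f = f and h = "\<lambda>_. 1" and x = x and N = N and l = l and ls = ls]
      snoc.IH[of "\<lambda>c. f c * leg_sum N x l c"]
    by (simp add: leg_sum_def mult_ac)
qed

lemma spider_eval:
  fixes x :: "nat \<Rightarrow> 'a::comm_ring_1"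
  shows "(\<Sum>c<N. x c * (\<Prod>l\<leftarrow>ls. leg_sum N x l c)) =
    (\<Sum>\<mu>\<in>partitions (Suc (sum_list ls)). of_int (e_coeff (spider_V ls) (spider_E ls) \<mu>) * prod_list (map (esym N x) \<mu>))"
  using sum_colorings_spider_weighted[where x = x and ls = ls and N = N and f = "\<lambda>_. 1"]
    e_expansion_eval[OF finite_spider_V, where x = x and N = N and E = "spider_E ls"]
  by (simp add: card_spider_V)


section \<open>The coefficient of \<open>e_(3,2^K)\<close>\<close>

lemma coeff_mult_1: "poly.coeff (p * q) 1 = poly.coeff p 0 * poly.coeff q 1 + poly.coeff p 1 * poly.coeff q 0"
  by (simp add: coeff_mult)

lemma prod_list_map_eq_0:
  fixes f :: "'b \<Rightarrow> 'a::comm_semiring_1"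
  shows "f m = 0 \<Longrightarrow> m \<in> set ms \<Longrightarrow> prod_list (map f ms) = 0"
  by (induction ms) auto

lemma leg_sum_0 [simp]: "leg_sum N x 0 c = 1"
  by (simp add: leg_sum_def)

lemma leg_sum_Suc: "leg_sum N x (Suc l) c = (\<Sum>b\<in>{..<N} - {c}. x b * leg_sum N x l b)"
  by (simp add: leg_sum_def walk_step_def)

definition test_point :: "nat \<Rightarrow> int poly" where
  "test_point = (\<lambda>_. 0)(0 := 1, 1 := [:-1, -1:], 2 := [:0, 1:])"

lemma test_point_simps [simp]:
  "test_point 0 = 1" "test_point (Suc 0) = [:-1, -1:]" "test_point 2 = [:0, 1:]"
  by (simp_all add: test_point_def)

abbreviation spec_leg :: "nat \<Rightarrow> nat \<Rightarrow> int poly" where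
  "spec_leg \<equiv> leg_sum 3 test_point"

lemma lessThan_3: "{..<3} = {0, Suc 0, 2::nat}"
  by auto

text \<open>The outer list is a polynomial in the generating variable, its entries are polynomials
  in z: the product of 1 + t, 1 - (1 + z) t and 1 + z t.\<close>

lemma esym_test_point:
  "esym 3 test_point k = poly.coeff [:1, 0, [:-1, -1, -1:], [:0, -1, -1:]:] k"
proof -
  have "(\<Prod>j<3. [:1, test_point j:]) = [:1, 0, [:-1, -1, -1:], [:0, -1, -1:]:]"
    by (simp add: lessThan_3 one_pCons)
  then show ?thesis by (simp flip: coeff_prod_linear)
qed

lemma partition_parts_2_3:
  fixes \<mu> :: "nat list"
  assumes "sorted_wrt (\<ge>) \<mu>" "set \<mu> \<subseteq> {2, 3}"
  shows "\<exists>a b. \<mu> = replicate a 3 @ replicate b 2"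
  using assms
proof (induction \<mu>)
  case (Cons m \<mu>)
  then obtain a b where ab: "\<mu> = replicate a 3 @ replicate b 2" by auto
  show ?case
  proof (cases "m = 3")
    case True
    then show ?thesis using ab by (intro exI[of _ "Suc a"] exI[of _ b]) simp
  next
    case False
    then have "m = 2" using Cons by simp
    then have "a = 0" using Cons.prems(1) ab by (cases a) auto
    then show ?thesis using ab \<open>m = 2\<close> by (intro exI[of _ 0] exI[of _ "Suc b"]) simp
  qed
qed simp

text \<open>Only parts 2 and 3 survive, and the odd size forces an odd number of parts 3. Each of
  them brings a factor z, so exactly one remains; it contributes -1, and so does each of the
  \<open>K\<close> parts 2.\<close>

lemma coeff_prod_esym_test_point:
  assumes "\<mu> \<in> partitions (2 * K + 3)"
  shows "poly.coeff (prod_list (map (esym 3 test_point) \<mu>)) 1 =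
    (if \<mu> = 3 # replicate K 2 then (-1) ^ Suc K else 0)"
proof (cases "set \<mu> \<subseteq> {2, 3}")
  case True
  then obtain a b where ab: "\<mu> = replicate a 3 @ replicate b 2"
    using assms partition_parts_2_3[of \<mu>] by (auto simp: partitions_def)
  have n: "3 * a + 2 * b = 2 * K + 3"
    using assms by (simp add: ab partitions_def sum_list_replicate)
  then have "odd (3 * a + 2 * b)" by simp
  then have "odd a" by simp
  have e: "esym 3 test_point 3 = [:0, -1, -1:]" "esym 3 test_point 2 = [:-1, -1, -1:]"
    unfolding esym_test_point by (simp_all add: numeral_eq_Suc)
  show ?thesis
  proof (cases "a = 1")
    case True
    then show ?thesis
      using n by (simp add: ab e coeff_mult_1[unfolded One_nat_def] coeff_0_power)
  next
    case False
    then obtain a' where a': "a = Suc (Suc a')" using \<open>odd a\<close> by (metis One_nat_def not0_implies_Suc odd_pos less_not_refl2)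
    have "3 \<in> set (replicate (Suc a') 3 @ replicate b (2 :: nat))" "3 \<notin> set (replicate K (2 :: nat))"
      by auto
    then have "\<mu> \<noteq> 3 # replicate K 2" by (metis a' ab append_Cons list.sel(3) replicate_Suc)
    then show ?thesis by (simp add: ab a' e coeff_mult_1[unfolded One_nat_def] coeff_mult_0)
  qed
next
  case False
  then obtain m where m: "m \<in> set \<mu>" "m \<noteq> 2" "m \<noteq> 3" by blast
  then have "m \<noteq> 0" using assms by (auto simp: partitions_def)
  \<comment> \<open>e_1 is 0 at this point, and e_m is 0 beyond three variables.\<close>
  then have "m = 1 \<or> (\<exists>r. m = Suc (Suc (Suc (Suc r))))"
    using m by (metis One_nat_def numeral_2_eq_2 numeral_3_eq_3 not0_implies_Suc)
  then have "esym 3 test_point m = 0" by (auto simp: esym_test_point)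
  then have "prod_list (map (esym 3 test_point) \<mu>) = 0"
    using m(1) by (rule prod_list_map_eq_0)
  moreover have "\<mu> \<noteq> 3 # replicate K 2" using m by auto
  ultimately show ?thesis by simp
qed

section \<open>Leg sums at the test point modulo z^2\<close>

lemma spec_leg_Suc:
  "spec_leg (Suc l) 0 = [:-1, -1:] * spec_leg l (Suc 0) + [:0, 1:] * spec_leg l 2"
  "spec_leg (Suc l) (Suc 0) = spec_leg l 0 + [:0, 1:] * spec_leg l 2"
  "spec_leg (Suc l) 2 = spec_leg l 0 + [:-1, -1:] * spec_leg l (Suc 0)"
proof -
  have "{..<3} - {0} = {Suc 0, 2::nat}" "{..<3} - {Suc 0} = {0, 2::nat}" "{..<3} - {2} = {0, Suc 0::nat}"
    by auto
  then show "spec_leg (Suc l) 0 = [:-1, -1:] * spec_leg l (Suc 0) + [:0, 1:] * spec_leg l 2"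
    "spec_leg (Suc l) (Suc 0) = spec_leg l 0 + [:0, 1:] * spec_leg l 2"
    "spec_leg (Suc l) 2 = spec_leg l 0 + [:-1, -1:] * spec_leg l (Suc 0)"
    by (simp_all add: leg_sum_Suc)
qed

text \<open>These five quantities form a closed recursion: the value at colour 2 always enters with
  weight z, so its linear coefficient never does.\<close>

lemma coeff_spec_leg_Suc:
  "poly.coeff (spec_leg (Suc l) 0) 0 = - poly.coeff (spec_leg l 1) 0"
  "poly.coeff (spec_leg (Suc l) 0) 1 =
     poly.coeff (spec_leg l 2) 0 - poly.coeff (spec_leg l 1) 0 - poly.coeff (spec_leg l 1) 1"
  "poly.coeff (spec_leg (Suc l) 1) 0 = poly.coeff (spec_leg l 0) 0"
  "poly.coeff (spec_leg (Suc l) 1) 1 = poly.coeff (spec_leg l 0) 1 + poly.coeff (spec_leg l 2) 0"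
  "poly.coeff (spec_leg (Suc l) 2) 0 = poly.coeff (spec_leg l 0) 0 - poly.coeff (spec_leg l 1) 0"
  by (simp_all add: spec_leg_Suc)

text \<open>The closed forms start at length 2, since the leg sum 1 of length 0 does not fit
  them.\<close>

lemma coeff_spec_leg_even:
  "poly.coeff (spec_leg (2 * Suc m) 0) 0 = (-1) ^ Suc m"
  "poly.coeff (spec_leg (2 * Suc m) 0) 1 = (-1) ^ Suc m * (3 * int (Suc m) - 1)"
  "poly.coeff (spec_leg (2 * Suc m) 1) 0 = (-1) ^ Suc m"
  "poly.coeff (spec_leg (2 * Suc m) 1) 1 = (-1) ^ Suc m * (1 - int (Suc m))"
  "poly.coeff (spec_leg (2 * Suc m) 2) 0 = 2 * (-1) ^ Suc m"
proof -
  have "poly.coeff (spec_leg (2 * Suc m) 0) 0 = (-1) ^ Suc m \<and>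
    poly.coeff (spec_leg (2 * Suc m) 0) 1 = (-1) ^ Suc m * (3 * int (Suc m) - 1) \<and>
    poly.coeff (spec_leg (2 * Suc m) 1) 0 = (-1) ^ Suc m \<and>
    poly.coeff (spec_leg (2 * Suc m) 1) 1 = (-1) ^ Suc m * (1 - int (Suc m)) \<and>
    poly.coeff (spec_leg (2 * Suc m) 2) 0 = 2 * (-1) ^ Suc m"
  proof (induction m)
    case 0
    have "2 * Suc 0 = Suc (Suc 0)" by simp
    then show ?case by (simp only: coeff_spec_leg_Suc) simp
  next
    case (Suc m)
    have two: "2 * Suc (Suc m) = Suc (Suc (2 * Suc m))" by simp
    show ?case using Suc unfolding two coeff_spec_leg_Suc by (simp add: algebra_simps)
  qed
  then show
    "poly.coeff (spec_leg (2 * Suc m) 0) 0 = (-1) ^ Suc m"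
    "poly.coeff (spec_leg (2 * Suc m) 0) 1 = (-1) ^ Suc m * (3 * int (Suc m) - 1)"
    "poly.coeff (spec_leg (2 * Suc m) 1) 0 = (-1) ^ Suc m"
    "poly.coeff (spec_leg (2 * Suc m) 1) 1 = (-1) ^ Suc m * (1 - int (Suc m))"
    "poly.coeff (spec_leg (2 * Suc m) 2) 0 = 2 * (-1) ^ Suc m"
    by blast+
qed

text \<open>One more step of the recursion from length \<open>2 * m\<close>; for
  \<open>m = 0\<close> it starts from the empty leg. The constant coefficient at colour 2
  cancels.\<close>

lemma coeff_spec_leg_odd:
  "poly.coeff (spec_leg (2 * m + 1) 0) 0 = - ((-1) ^ m)"
  "poly.coeff (spec_leg (2 * m + 1) 0) 1 = (-1) ^ m * int m"
  "poly.coeff (spec_leg (2 * m + 1) 1) 0 = (-1) ^ m"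
  "poly.coeff (spec_leg (2 * m + 1) 1) 1 = (-1) ^ m * (3 * int m + 1)"
  "poly.coeff (spec_leg (2 * m + 1) 2) 0 = 0"
proof -
  have one: "2 * m + 1 = Suc (2 * m)" by simp
  show
    "poly.coeff (spec_leg (2 * m + 1) 0) 0 = - ((-1) ^ m)"
    "poly.coeff (spec_leg (2 * m + 1) 0) 1 = (-1) ^ m * int m"
    "poly.coeff (spec_leg (2 * m + 1) 1) 0 = (-1) ^ m"
    "poly.coeff (spec_leg (2 * m + 1) 1) 1 = (-1) ^ m * (3 * int m + 1)"
    "poly.coeff (spec_leg (2 * m + 1) 2) 0 = 0"
    unfolding one coeff_spec_leg_Suc
    by (cases m; simp only: coeff_spec_leg_even; simp add: algebra_simps)+
qed

text \<open>Modulo z^2 constant coefficients multiply, and the ratios of linear to constant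
  coefficient add up: 3 k - 1 at colour 0 and 1 - k at colour 1. The number of legs enters the final
  formula here.\<close>

lemma coeff_prod_spec_leg_even:
  assumes "\<forall>k\<in>set ks. 1 \<le> k"
  shows "poly.coeff (\<Prod>k\<leftarrow>ks. spec_leg (2 * k) 0) 0 = (-1) ^ sum_list ks"
    "poly.coeff (\<Prod>k\<leftarrow>ks. spec_leg (2 * k) 0) 1 = (-1) ^ sum_list ks * (3 * int (sum_list ks) - int (length ks))"
    "poly.coeff (\<Prod>k\<leftarrow>ks. spec_leg (2 * k) 1) 0 = (-1) ^ sum_list ks"
    "poly.coeff (\<Prod>k\<leftarrow>ks. spec_leg (2 * k) 1) 1 = (-1) ^ sum_list ks * (int (length ks) - int (sum_list ks))"
proof -
  have "poly.coeff (\<Prod>k\<leftarrow>ks. spec_leg (2 * k) 0) 0 = (-1) ^ sum_list ks \<and>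
    poly.coeff (\<Prod>k\<leftarrow>ks. spec_leg (2 * k) 0) 1 = (-1) ^ sum_list ks * (3 * int (sum_list ks) - int (length ks)) \<and>
    poly.coeff (\<Prod>k\<leftarrow>ks. spec_leg (2 * k) 1) 0 = (-1) ^ sum_list ks \<and>
    poly.coeff (\<Prod>k\<leftarrow>ks. spec_leg (2 * k) 1) 1 = (-1) ^ sum_list ks * (int (length ks) - int (sum_list ks))"
    using assms
  proof (induction ks)
    case (Cons k ks)
    then obtain m where m: "k = Suc m" by (cases k) auto
    have IH: "poly.coeff (\<Prod>k\<leftarrow>ks. spec_leg (2 * k) 0) 0 = (-1) ^ sum_list ks"
      "poly.coeff (\<Prod>k\<leftarrow>ks. spec_leg (2 * k) 0) 1 = (-1) ^ sum_list ks * (3 * int (sum_list ks) - int (length ks))"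
      "poly.coeff (\<Prod>k\<leftarrow>ks. spec_leg (2 * k) 1) 0 = (-1) ^ sum_list ks"
      "poly.coeff (\<Prod>k\<leftarrow>ks. spec_leg (2 * k) 1) 1 = (-1) ^ sum_list ks * (int (length ks) - int (sum_list ks))"
      using Cons by auto
    show ?case
      unfolding m list.map prod_list.Cons coeff_mult_0 coeff_mult_1 coeff_spec_leg_even IH
      by (simp add: algebra_simps power_add)
  qed simp
  then show "poly.coeff (\<Prod>k\<leftarrow>ks. spec_leg (2 * k) 0) 0 = (-1) ^ sum_list ks"
    "poly.coeff (\<Prod>k\<leftarrow>ks. spec_leg (2 * k) 0) 1 = (-1) ^ sum_list ks * (3 * int (sum_list ks) - int (length ks))"
    "poly.coeff (\<Prod>k\<leftarrow>ks. spec_leg (2 * k) 1) 0 = (-1) ^ sum_list ks"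
    "poly.coeff (\<Prod>k\<leftarrow>ks. spec_leg (2 * k) 1) 1 = (-1) ^ sum_list ks * (int (length ks) - int (sum_list ks))"
    by blast+
qed

text \<open>The coefficient of z in the evaluation is computed twice: from the expansion, where one
  partition survives, and from the legs.\<close>

lemma e_coeff_3_2:
  assumes ls: "mset ls = mset ([2 * p + 1, 2 * q + 1] @ map (\<lambda>k. 2 * k) ks)"
    and ks: "\<forall>k\<in>set ks. 1 \<le> k"
  shows "e_coeff (spider_V ls) (spider_E ls) (3 # replicate (p + q + sum_list ks) 2) =
    4 * (int p + int q - int (sum_list ks)) + 2 * int (length ks) + 3"
proof -
  define K where "K = p + q + sum_list ks"
  define X where "X = (\<Sum>c<3. test_point c * (\<Prod>l\<leftarrow>ls. spec_leg l c))"
  let ?c = "e_coeff (spider_V ls) (spider_E ls)"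
  have "sum_list ls = sum_list ([2 * p + 1, 2 * q + 1] @ map (\<lambda>k. 2 * k) ks)"
    by (metis ls sum_mset_sum_list)
  then have n: "Suc (sum_list ls) = 2 * K + 3"
    by (simp add: K_def sum_list_const_mult)
  have "sorted_wrt (\<ge>) (replicate K (2 :: nat))" by (induction K) auto
  then have mem: "3 # replicate K 2 \<in> partitions (2 * K + 3)"
    by (simp add: partitions_def sum_list_replicate)
  have "poly.coeff X 1 = (\<Sum>\<mu>\<in>partitions (2 * K + 3).
      ?c \<mu> * poly.coeff (prod_list (map (esym 3 test_point) \<mu>)) 1)"
    unfolding X_def spider_eval n by (simp add: coeff_sum of_int_poly)
  also have "\<dots> = (\<Sum>\<mu>\<in>partitions (2 * K + 3). if \<mu> = 3 # replicate K 2 then ?c \<mu> * (-1) ^ Suc K else 0)"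
    by (rule sum.cong[OF refl], subst coeff_prod_esym_test_point[where K = K]) auto
  also have "\<dots> = ?c (3 # replicate K 2) * (-1) ^ Suc K"
    using mem finite_partitions by simp
  finally have X1: "poly.coeff X 1 = ?c (3 # replicate K 2) * (-1) ^ Suc K" .
  have prod: "(\<Prod>l\<leftarrow>ls. spec_leg l c) =
      spec_leg (2 * p + 1) c * (spec_leg (2 * q + 1) c * (\<Prod>k\<leftarrow>ks. spec_leg (2 * k) c))" for c
  proof -
    have "(\<Prod>l\<leftarrow>ls. spec_leg l c) = (\<Prod>l\<leftarrow>[2 * p + 1, 2 * q + 1] @ map (\<lambda>k. 2 * k) ks. spec_leg l c)"
      by (metis ls mset_map prod_mset_prod_list)
    then show ?thesis by (simp add: comp_def)
  qed
  have X: "X = (\<Prod>l\<leftarrow>ls. spec_leg l 0) + [:-1, -1:] * (\<Prod>l\<leftarrow>ls. spec_leg l 1) + [:0, 1:] * (\<Prod>l\<leftarrow>ls. spec_leg l 2)"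
    by (simp add: X_def lessThan_3)
  \<comment> \<open>With S = \<open>sum_list ks\<close>, m = \<open>length ks\<close> and up to the
    sign, colour 0 gives 3 S - m - p - q and colour 1 gives S - m - 3 p - 3 q - 3. Colour 2 gives 0:
    its weight is z and an odd leg has constant coefficient 0 there.\<close>
  have "poly.coeff X 1 = (-1) ^ K * (4 * int (sum_list ks) - 4 * (int p + int q) - 2 * int (length ks) - 3)"
    unfolding X prod coeff_add coeff_mult_1 coeff_mult_0 coeff_spec_leg_odd coeff_prod_spec_leg_even[OF ks]
    by (simp add: K_def power_add algebra_simps)
  then have "(-1) ^ K * ?c (3 # replicate K 2) =
      (-1) ^ K * (4 * (int p + int q - int (sum_list ks)) + 2 * int (length ks) + 3)"
    using X1 by (simp add: algebra_simps)
  then show ?thesis by (simp add: K_def)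
qed


section \<open>Two-part coefficients and non-positivity\<close>

lemma esym_nth: "esym (length ys) (nth ys) k = poly.coeff (\<Prod>y\<leftarrow>ys. [:1, y:]) k"
  by (simp add: prod.list_conv_set_nth atLeast0LessThan flip: coeff_prod_linear)

text \<open>A path on at most \<open>L\<close> vertices evaluates to 0, so the sum over all colours
  but \<open>c\<close> is minus the term at \<open>c\<close>; each vertex of the leg thus
  contributes a factor \<open>- x c\<close>.\<close>

lemma leg_sum_eq_power:
  assumes e: "\<And>k. 1 \<le> k \<Longrightarrow> k \<le> L \<Longrightarrow> esym N x k = 0" and "l \<le> L" "c < N"
  shows "leg_sum N x l c = (- x c) ^ l"
  using assms(2)
proof (induction l)
  case (Suc l)
  have "prod_list (map (esym N x) \<mu>) = 0" if \<mu>: "\<mu> \<in> partitions (Suc l)" for \<mu>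
  proof -
    obtain m where m: "m \<in> set \<mu>" using \<mu> by (cases \<mu>) (auto simp: partitions_def)
    then have "1 \<le> m" "m \<le> L" using \<mu> Suc.prems member_le_sum_list[of m \<mu>] by (auto simp: partitions_def Suc_le_eq)
    then have "esym N x m = 0" by (rule e)
    then show ?thesis using m by (rule prod_list_map_eq_0)
  qed
  \<comment> \<open>The spider with the single leg \<open>l\<close> is the path on
    \<open>Suc l\<close> vertices.\<close>
  then have "(\<Sum>b<N. x b * leg_sum N x l b) = 0"
    using spider_eval[where x = x and ls = "[l]" and N = N] by simp
  then have "leg_sum N x (Suc l) c = - (x c * leg_sum N x l c)"
    using \<open>c < N\<close> by (simp add: leg_sum_Suc sum_diff1)
  then show ?case using Suc by simp
qed simp

text \<open>A leg \<open>l\<close> contributes (-y)^l at a centre of weight y; as the total length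
  is even the signs cancel, leaving a power sum.\<close>

lemma spider_power_sum:
  fixes ys :: "'a::idom list"
  assumes "\<And>k. 1 \<le> k \<Longrightarrow> k \<le> L \<Longrightarrow> poly.coeff (\<Prod>y\<leftarrow>ys. [:1, y:]) k = 0"
    and "\<forall>l\<in>set ls. l \<le> L" "even (sum_list ls)"
  shows "(\<Sum>y\<leftarrow>ys. y ^ Suc (sum_list ls)) =
    (\<Sum>\<mu>\<in>partitions (Suc (sum_list ls)). of_int (e_coeff (spider_V ls) (spider_E ls) \<mu>) *
      prod_list (map (poly.coeff (\<Prod>y\<leftarrow>ys. [:1, y:])) \<mu>))"
proof -
  let ?N = "length ys" and ?x = "nth ys"
  have "(\<Prod>l\<leftarrow>ls. leg_sum ?N ?x l c) = ?x c ^ sum_list ls" if "c < ?N" for c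
  proof -
    have "(\<Prod>l\<leftarrow>ls. leg_sum ?N ?x l c) = (\<Prod>l\<leftarrow>ls. (- ?x c) ^ l)"
      using assms(1,2) that
      by (intro arg_cong[where f = prod_list] map_cong refl leg_sum_eq_power[where L = L])
        (auto simp: esym_nth)
    also have "\<dots> = (- ?x c) ^ sum_list ls" by (induction ls) (simp_all add: power_add)
    finally show ?thesis using assms(3) by simp
  qed
  then have "(\<Sum>c<?N. ?x c * (\<Prod>l\<leftarrow>ls. leg_sum ?N ?x l c)) = (\<Sum>y\<leftarrow>ys. y ^ Suc (sum_list ls))"
    by (simp add: sum_list_sum_nth atLeast0LessThan)
  then show ?thesis using spider_eval[where x = ?x and ls = ls and N = ?N] by (simp add: esym_nth[abs_def])
qed

text \<open>By the fundamental theorem of algebra the values of the elementary symmetric functions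
  can be prescribed freely at a complex point.\<close>

lemma linear_factorization:
  fixes p :: "complex poly"
  assumes "poly.coeff p 0 = 1"
  shows "\<exists>ys. p = (\<Prod>y\<leftarrow>ys. [:1, y:])"
  using assms
proof (induction "degree p" arbitrary: p rule: less_induct)
  case less
  show ?case
  proof (cases "degree p = 0")
    case True
    then have "p = 1" using less.prems by (metis degree_0_id one_pCons)
    then show ?thesis by (intro exI[of _ "[]"]) simp
  next
    case False
    then have "\<not> constant (poly p)" by (simp add: constant_degree)
    then obtain r where r: "poly p r = 0" using fundamental_theorem_of_algebra by blast
    then have "r \<noteq> 0" using less.prems by (auto simp: poly_0_coeff_0)
    obtain q where q: "p = [:- r, 1:] * q" using r by (auto simp: poly_eq_0_iff_dvd)
    have "p \<noteq> 0" using less.prems by auto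
    then have "q \<noteq> 0" using q by auto
    \<comment> \<open>The factor of the root is rescaled to constant coefficient 1, and the scalar
      moves to the cofactor.\<close>
    have "[:- r, 1:] = smult (- r) [:1, - inverse r:]" using \<open>r \<noteq> 0\<close> by simp
    then have p: "p = [:1, - inverse r:] * smult (- r) q"
      by (simp only: q mult_smult_left mult_smult_right)
    have "degree (smult (- r) q) < degree p"
      using \<open>q \<noteq> 0\<close> \<open>r \<noteq> 0\<close> unfolding q by (subst degree_mult_eq) simp_all
    moreover have "poly.coeff (smult (- r) q) 0 = 1"
      using less.prems by (simp add: q)
    ultimately obtain ys where "smult (- r) q = (\<Prod>y\<leftarrow>ys. [:1, y:])"
      using less.hyps by blast
    then have "p = (\<Prod>y\<leftarrow>- inverse r # ys. [:1, y:])" using p by simp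
    then show ?thesis by blast
  qed
qed

text \<open>The parts left after removing \<open>A\<close> are positive with sum 0, so there are
  none.\<close>

lemma partition_eqI:
  assumes "\<mu> \<in> partitions n" "A \<subseteq># mset \<mu>" "sum_mset A = n"
  shows "mset \<mu> = A"
proof -
  have "sum_mset (mset \<mu>) = sum_mset A + sum_mset (mset \<mu> - A)"
    using assms(2) by (metis subset_mset.add_diff_inverse sum_mset.union)
  then have "sum_mset (mset \<mu> - A) = 0"
    using assms by (simp add: partitions_def sum_mset_sum_list)
  moreover have "0 \<notin># mset \<mu> - A"
    using assms(1) in_diffD by (fastforce simp: partitions_def)
  ultimately have "mset \<mu> - A = {#}" by (metis multiset_nonemptyE sum_mset_0_iff)
  then show ?thesis using assms(2) by (metis subset_mset.add_diff_inverse add.right_neutral)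
qed

lemma singleton_partition: "0 < n \<Longrightarrow> [n] \<in> partitions n"
  by (simp add: partitions_def)

lemma partition_with_whole_part:
  assumes "\<mu> \<in> partitions n" "n \<in> set \<mu>"
  shows "\<mu> = [n]"
  using partition_eqI[OF assms(1), of "{#n#}"] assms(2) by simp

text \<open>At a point with e_n = 1 and all other positive-degree e_k equal to 0, the expansion
  reduces to the coefficient of e_n, and the power sum counts the nonzero entries.\<close>

lemma e_coeff_whole_pos:
  assumes "even (sum_list ls)"
  shows "0 < e_coeff (spider_V ls) (spider_E ls) [Suc (sum_list ls)]"
proof -
  define n where "n = Suc (sum_list ls)"
  define P :: "complex poly" where "P = 1 + monom 1 n"
  let ?c = "e_coeff (spider_V ls) (spider_E ls)"
  have coeff: "poly.coeff P k = (if k = 0 \<or> k = n then 1 else 0)" for k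
    by (auto simp: P_def n_def coeff_1)
  then obtain ys where ys: "P = (\<Prod>y\<leftarrow>ys. [:1, y:])" using linear_factorization by metis
  \<comment> \<open>\<open>- inverse y\<close> is a root of \<open>P\<close>, and \<open>n\<close>
    is odd.\<close>
  have root: "y ^ n = 1" if y: "y \<in> set ys" "y \<noteq> 0" for y
  proof -
    have "poly P z = (\<Prod>y\<leftarrow>ys. 1 + y * z)" for z
      unfolding ys by (induction ys) (simp_all add: algebra_simps)
    then have "poly P (- inverse y) = 0"
      using y by (force simp: prod_list_zero_iff)
    moreover have "odd n" using assms by (simp add: n_def)
    ultimately have "inverse y ^ n = 1" by (simp add: P_def poly_monom)
    then show ?thesis by (simp add: power_inverse)
  qed
  have "(\<Sum>y\<leftarrow>ys. y ^ n) = of_nat (length (filter (\<lambda>y. y \<noteq> 0) ys))"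
    using root by (induction ys) (auto simp: n_def)
  moreover have "(\<Sum>y\<leftarrow>ys. y ^ n) = of_int (?c [n])"
  proof -
    have val: "prod_list (map (poly.coeff P) \<mu>) = (if \<mu> = [n] then 1 else 0)" if \<mu>: "\<mu> \<in> partitions n" for \<mu>
    proof (cases "\<exists>m\<in>set \<mu>. m \<noteq> n")
      case True
      then obtain m where m: "m \<in> set \<mu>" "m \<noteq> n" by blast
      then have "poly.coeff P m = 0" using \<mu> by (auto simp: coeff partitions_def)
      then have "prod_list (map (poly.coeff P) \<mu>) = 0"
        using m(1) by (rule prod_list_map_eq_0)
      then show ?thesis using m by auto
    next
      case False
      moreover have "\<mu> \<noteq> []" using \<mu> by (auto simp: partitions_def n_def)
      ultimately have "\<mu> = [n]" using partition_with_whole_part[OF \<mu>] by (cases \<mu>) auto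
      then show ?thesis by (simp add: coeff)
    qed
    have "(\<Sum>y\<leftarrow>ys. y ^ n) = (\<Sum>\<mu>\<in>partitions n. of_int (?c \<mu>) * prod_list (map (poly.coeff P) \<mu>))"
      unfolding n_def ys
      by (rule spider_power_sum[where L = "sum_list ls"])
        (use assms in \<open>auto simp: coeff n_def member_le_sum_list simp flip: ys\<close>)
    also have "\<dots> = (\<Sum>\<mu>\<in>{[n]}. of_int (?c \<mu>))"
      by (rule sum.mono_neutral_cong_right) (auto simp: finite_partitions val coeff singleton_partition n_def)
    finally show ?thesis by simp
  qed
  ultimately have "?c [n] = int (length (filter (\<lambda>y. y \<noteq> 0) ys))"
    by (metis of_int_eq_iff of_int_of_nat_eq)
  \<comment> \<open>The factorization may contain zero entries; if there were no others,
    \<open>P\<close> would be 1.\<close>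
  moreover have "filter (\<lambda>y. y \<noteq> 0) ys \<noteq> []"
  proof
    assume "filter (\<lambda>y. y \<noteq> 0) ys = []"
    then have "P = 1" unfolding ys by (induction ys) (auto simp: one_pCons split: if_splits)
    then show False using coeff[of n] by (simp add: n_def)
  qed
  ultimately show ?thesis by (simp add: n_def)
qed

text \<open>The power sum is a function of \<alpha> plus a function of \<beta>, so its mixed
  difference over the signs vanishes. In the expansion only the partitions \<open>[n]\<close> and
  \<open>[b, a]\<close>, both of value \<alpha> \<beta>, have a nonzero mixed difference.\<close>

lemma e_coeff_two_parts:
  assumes legs: "\<forall>l\<in>set ls. l < a" and "a < b" "a + b = Suc (sum_list ls)" "even (sum_list ls)" "0 < a"
  shows "e_coeff (spider_V ls) (spider_E ls) [b, a] = - e_coeff (spider_V ls) (spider_E ls) [a + b]"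
proof -
  define n where "n = a + b"
  let ?c = "e_coeff (spider_V ls) (spider_E ls)"
  define Q :: "complex \<Rightarrow> complex \<Rightarrow> complex poly" where
    "Q \<alpha> \<beta> = (1 + monom \<alpha> a) * (1 + monom \<beta> b)" for \<alpha> \<beta>
  have coeff: "poly.coeff (Q \<alpha> \<beta>) k = (if k = 0 then 1 else if k = a then \<alpha> else if k = b then \<beta>
      else if k = n then \<alpha> * \<beta> else 0)" for \<alpha> \<beta> k
    using assms by (auto simp: Q_def n_def algebra_simps mult_monom coeff_1)
  have ex: "\<forall>\<alpha>. \<exists>ys. 1 + monom \<alpha> m = (\<Prod>y\<leftarrow>ys. [:1, y :: complex:])" if "0 < m" for m
    using that by (intro allI linear_factorization) simp
  obtain Y where Y: "\<And>\<alpha>. 1 + monom \<alpha> a = (\<Prod>y\<leftarrow>Y \<alpha>. [:1, y :: complex:])"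
    using choice[OF ex[OF \<open>0 < a\<close>]] by blast
  obtain Z where Z: "\<And>\<beta>. 1 + monom \<beta> b = (\<Prod>y\<leftarrow>Z \<beta>. [:1, y :: complex:])"
    using choice[OF ex[of b]] \<open>a < b\<close> by auto
  define w where "w \<mu> \<alpha> \<beta> = prod_list (map (poly.coeff (Q \<alpha> \<beta>)) \<mu>)" for \<mu> \<alpha> \<beta>
  have eval: "(\<Sum>y\<leftarrow>Y \<alpha>. y ^ n) + (\<Sum>y\<leftarrow>Z \<beta>. y ^ n) = (\<Sum>\<mu>\<in>partitions n. of_int (?c \<mu>) * w \<mu> \<alpha> \<beta>)" for \<alpha> \<beta>
  proof -
    have Q: "Q \<alpha> \<beta> = (\<Prod>y\<leftarrow>Y \<alpha> @ Z \<beta>. [:1, y:])" by (simp add: Q_def Y Z)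
    have "poly.coeff (\<Prod>y\<leftarrow>Y \<alpha> @ Z \<beta>. [:1, y:]) k = 0" if "1 \<le> k" "k \<le> a - 1" for k
    proof -
      have "k \<noteq> 0" "k \<noteq> a" "k \<noteq> b" "k \<noteq> n" using that assms by (auto simp: n_def)
      then show ?thesis using coeff[of \<alpha> \<beta> k] by (simp only: Q if_False)
    qed
    then have "(\<Sum>y\<leftarrow>Y \<alpha> @ Z \<beta>. y ^ n) = (\<Sum>\<mu>\<in>partitions n. of_int (?c \<mu>) * w \<mu> \<alpha> \<beta>)"
      unfolding w_def Q n_def assms(3)
      by (rule spider_power_sum[where L = "a - 1"]) (use assms in auto)
    then show ?thesis by simp
  qed
  \<comment> \<open>The mixed difference at \<alpha>, \<beta> = 1, -1; it takes \<alpha> \<beta> to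
    4 and kills whatever is independent of \<alpha> or of \<beta>.\<close>
  define D where "D \<mu> = w \<mu> 1 1 - w \<mu> 1 (-1) - w \<mu> (-1) 1 + w \<mu> (-1) (-1)" for \<mu>
  have D: "D \<mu> = (if \<mu> = [n] \<or> \<mu> = [b, a] then 4 else 0)" if \<mu>: "\<mu> \<in> partitions n" for \<mu>
  proof -
    have pos: "0 < m" if "m \<in> set \<mu>" for m using \<mu> that by (simp add: partitions_def)
    \<comment> \<open>A part whose coefficient is 0; the whole partition; both \<open>a\<close> and
      \<open>b\<close>, which already sum to \<open>n\<close>; or equal parts \<open>a\<close> or
      \<open>b\<close> only, where one parameter is absent.\<close>
    consider m where "m \<in> set \<mu>" "m \<noteq> a" "m \<noteq> b" "m \<noteq> n" | "n \<in> set \<mu>"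
      | "a \<in> set \<mu>" "b \<in> set \<mu>" | "set \<mu> \<subseteq> {a}" | "set \<mu> \<subseteq> {b}"
      by blast
    then show ?thesis
    proof cases
      case 1
      then have "poly.coeff (Q \<alpha> \<beta>) m = 0" for \<alpha> \<beta> using pos[of m] by (simp add: coeff)
      then have "w \<mu> \<alpha> \<beta> = 0" for \<alpha> \<beta>
        unfolding w_def using 1(1) by (rule prod_list_map_eq_0)
      then show ?thesis using 1 by (auto simp: D_def)
    next
      case 2
      then have "\<mu> = [n]" using partition_with_whole_part \<mu> by blast
      then show ?thesis using assms by (simp add: D_def w_def coeff n_def)
    next
      case 3
      then have "{#a, b#} \<subseteq># mset \<mu>"
        using \<open>a < b\<close> by (simp add: insert_subset_eq_iff in_diff_count)
      then have "mset \<mu> = {#a, b#}" using partition_eqI[OF \<mu>] by (simp add: n_def)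
      then have "\<mu> = [b, a]"
        using \<mu> \<open>a < b\<close> by (intro sorted_ge_eqI) (auto simp: partitions_def)
      then show ?thesis using assms by (simp add: D_def w_def coeff n_def)
    next
      case 4
      have "w \<mu> \<alpha> 1 = w \<mu> \<alpha> (-1)" for \<alpha>
        unfolding w_def using 4 assms by (intro arg_cong[where f = prod_list] map_cong) (auto simp: coeff)
      moreover have "\<mu> \<noteq> [n]" "\<mu> \<noteq> [b, a]" using 4 assms by (auto simp: n_def)
      ultimately show ?thesis by (simp add: D_def)
    next
      case 5
      have "w \<mu> 1 \<beta> = w \<mu> (-1) \<beta>" for \<beta>
        unfolding w_def using 5 assms by (intro arg_cong[where f = prod_list] map_cong) (auto simp: coeff)
      moreover have "\<mu> \<noteq> [n]" "\<mu> \<noteq> [b, a]" using 5 assms by (auto simp: n_def)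
      ultimately show ?thesis by (simp add: D_def)
    qed
  qed
  have mem: "[n] \<in> partitions n" "[b, a] \<in> partitions n"
    using assms by (auto simp: partitions_def n_def)
  have "(\<Sum>\<mu>\<in>partitions n. of_int (?c \<mu>) * D \<mu>) = 0"
    unfolding D_def distrib_left right_diff_distrib sum.distrib sum_subtractf eval[symmetric]
    by simp
  moreover have "(\<Sum>\<mu>\<in>partitions n. of_int (?c \<mu>) * D \<mu>) = (\<Sum>\<mu>\<in>{[n], [b, a]}. of_int (?c \<mu>) * 4)"
    by (rule sum.mono_neutral_cong_right) (use mem in \<open>auto simp: finite_partitions D\<close>)
  ultimately have "of_int (4 * (?c [n] + ?c [b, a])) = (0 :: complex)"
    by (simp add: algebra_simps)
  then have "4 * (?c [n] + ?c [b, a]) = 0" by (simp only: of_int_eq_0_iff)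
  then show ?thesis by (simp add: n_def)
qed

section \<open>A negative coefficient from the longest leg\<close>

text \<open>Long legs elsewhere leave room for two distinct parts beyond \<open>L\<close>, giving a
  negative two-part coefficient; otherwise the even leg \<open>L\<close> holds about half of the
  vertices and the coefficient of e_(3,2^K) is negative.\<close>

lemma spider_not_e_positive:
  assumes len: "length ls \<ge> 4" and pos: "\<forall>l\<in>set ls. 0 < l"
    and two_odd: "card {i. i < length ls \<and> odd (ls ! i)} = 2"
    and longest: "i < length ls" "ls ! i = Max (set ls)" "even (ls ! i)"
  shows "\<not> e_positive (spider_V ls) (spider_E ls)"
proof -
  define ks where "ks = map (\<lambda>l. l div 2) (filter even ls)"
  define L where "L = Max (set ls)"
  have "length (filter odd ls) = Suc (Suc 0)" using two_odd by (simp add: length_filter_conv_card)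
  then obtain s t where st: "filter odd ls = [s, t]" by (auto simp: length_Suc_conv)
  have "set (filter odd ls) \<subseteq> {l. odd l}" by auto
  then have "odd s" "odd t" by (simp_all add: st)
  then obtain p q where pq: "s = 2 * p + 1" "t = 2 * q + 1" by (auto elim!: oddE)
  have "map (\<lambda>k. 2 * k) ks = filter even ls" unfolding ks_def map_map o_def by (rule map_idI) auto
  moreover have "mset ls = mset (filter odd ls) + mset (filter even ls)"
    using multiset_partition[of "mset ls" odd] by simp
  ultimately have ls: "mset ls = mset ([2 * p + 1, 2 * q + 1] @ map (\<lambda>k. 2 * k) ks)"
    using st pq by simp
  have ks: "\<forall>k\<in>set ks. 1 \<le> k" using pos by (auto simp: ks_def elim!: evenE)
  have len_ks: "length ls = length ks + 2"
    using arg_cong[OF ls, of size] by simp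
  have "sum_list ls = sum_list ([2 * p + 1, 2 * q + 1] @ map (\<lambda>k. 2 * k) ks)"
    by (metis ls sum_mset_sum_list)
  then have sum: "sum_list ls = 2 * (p + q + sum_list ks + 1)" by (simp add: sum_list_const_mult)
  have le: "\<forall>l\<in>set ls. l \<le> L" by (simp add: L_def)
  have "\<exists>\<mu>. e_coeff (spider_V ls) (spider_E ls) \<mu> < 0"
  proof (cases "2 * (L + 1) \<le> Suc (sum_list ls)")
    case True
    define b where "b = Suc (sum_list ls) - (L + 1)"
    have "L + 1 + b = Suc (sum_list ls)" using True by (simp add: b_def)
    \<comment> \<open>Strict because the number of vertices is odd.\<close>
    moreover have "L + 1 < b" using True sum unfolding b_def by presburger
    ultimately have "e_coeff (spider_V ls) (spider_E ls) [b, L + 1] =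
        - e_coeff (spider_V ls) (spider_E ls) [Suc (sum_list ls)]"
      using e_coeff_two_parts[of ls "L + 1" b] le sum by (simp add: less_Suc_eq_le)
    then show ?thesis using e_coeff_whole_pos[of ls] sum by (metis dvd_triv_left neg_less_0_iff_less)
  next
    case False
    have "L \<in> set ls" "even L" using longest by (auto simp: L_def dest: nth_mem)
    then have "L div 2 \<in> set ks" by (auto simp: ks_def)
    then obtain k where k: "L = 2 * k" "k \<in> set ks" using \<open>even L\<close> by auto
    \<comment> \<open>Every other even leg has half-length at least 1.\<close>
    have "int k + int (length ks) \<le> int (sum_list ks) + 1"
    proof -
      have "length xs \<le> sum_list xs" if "\<forall>k\<in>set xs. 1 \<le> k" for xs :: "nat list"
        using that by (induction xs) auto
      moreover obtain xs where "mset ks = mset (k # xs)"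
        using k(2) by (metis ex_mset mset.simps(2) multi_member_split set_mset_mset)
      moreover from this have "sum_list ks = k + sum_list xs" "length ks = Suc (length xs)"
        "set ks = insert k (set xs)"
        by (metis sum_mset_sum_list sum_list.Cons, metis mset_eq_length length_Cons,
            metis mset_eq_setD list.simps(15))
      ultimately show ?thesis using ks by simp
    qed
    moreover have "int p + int q + int (sum_list ks) + 1 \<le> 2 * int k" using False sum k(1) by simp
    moreover have "2 \<le> int (length ks)" using len len_ks by simp
    \<comment> \<open>With m = \<open>length ks\<close>, the two bounds give p + q -
      \<open>sum_list ks\<close> at most 1 - 2 m, so the whole is at most 7 - 6 m, and m is at least
      2.\<close>
    ultimately have "4 * (int p + int q - int (sum_list ks)) + 2 * int (length ks) + 3 < 0"
      by (simp add: algebra_simps)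
    then show ?thesis using e_coeff_3_2[OF ls ks] by metis
  qed
  then show ?thesis by (auto simp: e_positive_def not_le)
qed

theorem theorem5p3:
  shows "(\<forall>(ls :: nat list) (ks :: nat list).
            length ls \<ge> 2 \<and> (\<forall>l \<in> set ls. 0 < l) \<and>
            odd (card (spider_V ls)) \<and>
            length ks = length ls \<and>
            (\<forall>i. 2 \<le> i \<and> i < length ks \<longrightarrow> 1 \<le> ks ! i) \<and>
            mset ls = mset ([2 * ks ! 0 + 1, 2 * ks ! 1 + 1] @ map (\<lambda>k. 2 * k) (drop 2 ks))
          \<longrightarrow> e_coeff (spider_V ls) (spider_E ls) (3 # replicate (sum_list ks) 2)
              = 4 * (int (ks ! 0) + int (ks ! 1) - int (sum_list (drop 2 ks)))
                + 2 * int (length ls) - 1)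
       \<and>
       (\<forall>ls :: nat list.
            length ls \<ge> 4 \<and> (\<forall>l \<in> set ls. 0 < l) \<and>
            card {i. i < length ls \<and> odd (ls ! i)} = 2 \<and>
            (\<exists>i < length ls. ls ! i = Max (set ls) \<and> even (ls ! i))
          \<longrightarrow> \<not> e_positive (spider_V ls) (spider_E ls))"
proof (intro conjI allI impI)
  fix ls ks :: "nat list"
  assume *: "length ls \<ge> 2 \<and> (\<forall>l \<in> set ls. 0 < l) \<and>
            odd (card (spider_V ls)) \<and>
            length ks = length ls \<and>
            (\<forall>i. 2 \<le> i \<and> i < length ks \<longrightarrow> 1 \<le> ks ! i) \<and>
            mset ls = mset ([2 * ks ! 0 + 1, 2 * ks ! 1 + 1] @ map (\<lambda>k. 2 * k) (drop 2 ks))"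
  then obtain p q ks' where ks: "ks = p # q # ks'"
    by (cases ks; cases "tl ks") auto
  have ge1: "1 \<le> ks ! i" if "2 \<le> i" "i < length ks" for i using * that by blast
  have "\<forall>k\<in>set ks'. 1 \<le> k"
  proof
    fix k assume "k \<in> set ks'"
    then obtain i where "i < length ks'" "k = ks' ! i" by (metis in_set_conv_nth)
    moreover have "1 \<le> ks ! (i + 2)" if "i < length ks'" using ge1[of "i + 2"] that by (simp add: ks)
    ultimately show "1 \<le> k" by (simp add: ks)
  qed
  moreover have "mset ls = mset ([2 * p + 1, 2 * q + 1] @ map (\<lambda>k. 2 * k) ks')"
    using * by (simp add: ks)
  ultimately have "e_coeff (spider_V ls) (spider_E ls) (3 # replicate (p + q + sum_list ks') 2) =
      4 * (int p + int q - int (sum_list ks')) + 2 * int (length ks') + 3"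
    by (intro e_coeff_3_2)
  moreover have "length ls = length ks' + 2" using * by (simp add: ks)
  ultimately show "e_coeff (spider_V ls) (spider_E ls) (3 # replicate (sum_list ks) 2)
              = 4 * (int (ks ! 0) + int (ks ! 1) - int (sum_list (drop 2 ks)))
                + 2 * int (length ls) - 1"
    by (simp add: ks add.assoc)
next
  fix ls :: "nat list"
  assume "length ls \<ge> 4 \<and> (\<forall>l \<in> set ls. 0 < l) \<and>
            card {i. i < length ls \<and> odd (ls ! i)} = 2 \<and>
            (\<exists>i < length ls. ls ! i = Max (set ls) \<and> even (ls ! i))"
  then show "\<not> e_positive (spider_V ls) (spider_E ls)"
    using spider_not_e_positive by blast
qed

end
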